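(* Consider a CoMP BC under the finite-field model over $\mathbb F_q$ with connectivity matrix $\mathbf M\in\{0,*\}^{K\times B}$. Then for every prime power $q$, the NS-assisted sum-capacity satisfies $$\frac{C_\Sigma^{\mathrm{NS}}(q)}{\log_2 q}\le \operatorname{minrk}_q(\mathbf M),$$ and consequently the NS-assisted sum-DoF satisfies $d_\Sigma^{\mathrm{NS}}\le\liminf_{q\to\infty}\operatorname{minrk}_q(\mathbf M)$ (limit along prime powers).
   Context: CoMP BC, finite-field model: $B$ transmit antennas, $K$ receivers, connectivity $\mathbf M\in\{0,*\}^{K\times B}$. At use $\tau$ the transmitter sends $X^{(\tau)}\in\mathbb F_q^B$ and Rx-$k$ observes $(Y_k^{(\tau)},(G_{kj}^{(\tau)})_j)$, $Y_k^{(\tau)}=\sum_jG_{kj}^{(\tau)}X_j^{(\tau)}$; coefficients mutually independent over $k,j,\tau$ and of the messages, uniform on $\mathbb F_q^\times$ if $M_{kj}=*$, else $0$. Messages $W_k$ independent, uniform on finite $\mathcal M_k$. A $\kappa$-partite NS box is a conditional pmf of outputs given inputs (finite output alphabets) whose output marginals for any subset of parties depend only on those parties' inputs. An NS-assisted scheme is a $(K+1)$-partite NS box where the transmitter inputs $(W_1,\dots,W_K)$ and obtains the channel input sequence, and Rx-$k$ inputs its channel output sequence and obtains $\hat W_k$; joint law = uniform message pmf $\times$ box $\times$ channel. Rates are achievable if some sequence of schemes has vanishing $\max_k\Pr(\hat W_k\ne W_k)$ and $\lim\frac1n\log_2|\mathcal M_k|\ge R_k$; $C_\Sigma^{\mathrm{NS}}(q)$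 is the maximal sum of achievable rates (over the closure). A DoF tuple is achievable if for each prime power $q$ some NS-achievable rate tuple has $\lim_q R_k(q)/\log_2q\ge d_k$; $d_\Sigma^{\mathrm{NS}}$ is the maximal sum over the closure of such tuples. Min-rank: $\operatorname{minrk}_q(\mathbf M)=\min\{\mathrm{rank}(\overline{\mathbf G}):\overline{\mathbf G}\in\mathbb F_q^{K\times B},\ \overline G_{ij}=0\iff M_{ij}=0\}$. *)

theory Defs
  imports "HOL-Analysis.Analysis" "HOL-Algebra.Ring" "HOL-Number_Theory.Prime_Powers"
begin

text \<open>A fixed representative of the field with q elements, carried by the set {0,...,q-1}.
  All quantities below depend on the field only up to isomorphism.\<close>
definition fieldq :: "nat \<Rightarrow> nat ring" where
  "fieldq q = (SOME R. field R \<and> carrier R = {..<q})"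

definition rows_indep :: "('a, 'b) ring_scheme \<Rightarrow> nat \<Rightarrow> (nat \<Rightarrow> nat \<Rightarrow> 'a) \<Rightarrow> nat set \<Rightarrow> bool" where
  "rows_indep R B G S \<longleftrightarrow>
     (\<forall>c \<in> S \<rightarrow> carrier R.
        (\<forall>j<B. finsum R (\<lambda>i. mult R (c i) (G i j)) S = zero R) \<longrightarrow> (\<forall>i\<in>S. c i = zero R))"

definition mat_rank :: "('a, 'b) ring_scheme \<Rightarrow> nat \<Rightarrow> nat \<Rightarrow> (nat \<Rightarrow> nat \<Rightarrow> 'a) \<Rightarrow> nat" where
  "mat_rank R K B G = Max {card S | S. S \<subseteq> {..<K} \<and> rows_indep R B G S}"

text \<open>Connectivity matrix: M k j = True means entry *, False means 0.\<close>
definition minrk :: "('a, 'b) ring_scheme \<Rightarrow> nat \<Rightarrow> nat \<Rightarrow> (nat \<Rightarrow> nat \<Rightarrow> bool) \<Rightarrow> nat" where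
  "minrk R K B M = Min {mat_rank R K B G | G.
      (\<forall>i<K. \<forall>j<B. G i j \<in> carrier R \<and> (G i j = zero R \<longleftrightarrow> \<not> M i j))}"

definition ns_box :: "nat \<Rightarrow> (nat \<Rightarrow> 'i set) \<Rightarrow> (nat \<Rightarrow> 'o set)
                      \<Rightarrow> ((nat \<Rightarrow> 'i) \<Rightarrow> (nat \<Rightarrow> 'o) \<Rightarrow> real) \<Rightarrow> bool" where
  "ns_box \<kappa> In Ou P \<longleftrightarrow>
     (\<forall>p<\<kappa>. finite (Ou p)) \<and>
     (\<forall>x\<in>PiE {..<\<kappa>} In. \<forall>a\<in>PiE {..<\<kappa>} Ou. 0 \<le> P x a) \<and>
     (\<forall>x\<in>PiE {..<\<kappa>} In. (\<Sum>a\<in>PiE {..<\<kappa>} Ou. P x a) = 1) \<and>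
     (\<forall>S\<subseteq>{..<\<kappa>}. \<forall>x\<in>PiE {..<\<kappa>} In. \<forall>x'\<in>PiE {..<\<kappa>} In.
        (\<forall>p\<in>S. x p = x' p) \<longrightarrow>
        (\<forall>a\<in>PiE {..<\<kappa>} Ou.
           (\<Sum>a'\<in>{a'\<in>PiE {..<\<kappa>} Ou. \<forall>p\<in>S. a' p = a p}. P x a') =
           (\<Sum>a'\<in>{a'\<in>PiE {..<\<kappa>} Ou. \<forall>p\<in>S. a' p = a p}. P x' a')))"

text \<open>Sequences over n channel uses. A channel input sequence X: X tau j = X_j^(tau).
  Channel coefficients G: G k tau j = G_kj^(tau). Messages w: w k in {..<m k}.\<close>

definition Xset :: "('a, 'b) ring_scheme \<Rightarrow> nat \<Rightarrow> nat \<Rightarrow> (nat \<Rightarrow> nat \<Rightarrow> 'a) set" where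
  "Xset R n B = PiE {..<n} (\<lambda>_. PiE {..<B} (\<lambda>_. carrier R))"

definition Yset :: "('a, 'b) ring_scheme \<Rightarrow> nat \<Rightarrow> (nat \<Rightarrow> 'a) set" where
  "Yset R n = PiE {..<n} (\<lambda>_. carrier R)"

definition Wset :: "nat \<Rightarrow> (nat \<Rightarrow> nat) \<Rightarrow> (nat \<Rightarrow> nat) set" where
  "Wset K m = PiE {..<K} (\<lambda>k. {..<m k})"

text \<open>Support of the channel coefficients; they are uniform on this product set, i.e.
  mutually independent, uniform on F_q^* where M k j = *, and 0 otherwise.\<close>
definition Gset :: "('a, 'b) ring_scheme \<Rightarrow> nat \<Rightarrow> nat \<Rightarrow> (nat \<Rightarrow> nat \<Rightarrow> bool) \<Rightarrow> nat
                    \<Rightarrow> (nat \<Rightarrow> nat \<Rightarrow> nat \<Rightarrow> 'a) set" where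
  "Gset R K B M n = PiE {..<K} (\<lambda>k. PiE {..<n} (\<lambda>\<tau>. PiE {..<B}
       (\<lambda>j. if M k j then carrier R - {zero R} else {zero R})))"

definition chan_out :: "('a, 'b) ring_scheme \<Rightarrow> nat \<Rightarrow> nat \<Rightarrow> (nat \<Rightarrow> nat \<Rightarrow> nat \<Rightarrow> 'a)
                        \<Rightarrow> (nat \<Rightarrow> nat \<Rightarrow> 'a) \<Rightarrow> nat \<Rightarrow> (nat \<Rightarrow> 'a)" where
  "chan_out R B n G X k = restrict (\<lambda>\<tau>. finsum R (\<lambda>j. mult R (G k \<tau> j) (X \<tau> j)) {..<B}) {..<n}"

text \<open>Party 0 is the transmitter (input: message tuple, output: channel input sequence);
  party k+1 is Rx-k (input: its output sequence and its coefficient sequence, output: decoded message).\<close>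
type_synonym 'a box_in = "(nat \<Rightarrow> nat) + ((nat \<Rightarrow> 'a) \<times> (nat \<Rightarrow> nat \<Rightarrow> 'a))"
type_synonym 'a box_out = "(nat \<Rightarrow> nat \<Rightarrow> 'a) + nat"
type_synonym 'a scheme_box = "(nat \<Rightarrow> 'a box_in) \<Rightarrow> (nat \<Rightarrow> 'a box_out) \<Rightarrow> real"

definition sch_I :: "('a, 'b) ring_scheme \<Rightarrow> nat \<Rightarrow> nat \<Rightarrow> nat \<Rightarrow> (nat \<Rightarrow> nat) \<Rightarrow> nat \<Rightarrow> 'a box_in set" where
  "sch_I R K B n m p = (if p = 0 then Inl ` Wset K m else Inr ` (Yset R n \<times> Xset R n B))"

definition sch_O :: "('a, 'b) ring_scheme \<Rightarrow> nat \<Rightarrow> nat \<Rightarrow> nat \<Rightarrow> (nat \<Rightarrow> nat) \<Rightarrow> nat \<Rightarrow> 'a box_out set" where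
  "sch_O R K B n m p = (if p = 0 then Inl ` Xset R n B else Inr ` {..<m (p - 1)})"

definition ns_scheme :: "('a, 'b) ring_scheme \<Rightarrow> nat \<Rightarrow> nat \<Rightarrow> nat \<Rightarrow> (nat \<Rightarrow> nat) \<Rightarrow> 'a scheme_box \<Rightarrow> bool" where
  "ns_scheme R K B n m P \<longleftrightarrow> 0 < n \<and> (\<forall>k<K. 0 < m k) \<and>
      ns_box (Suc K) (sch_I R K B n m) (sch_O R K B n m) P"

definition sch_in :: "('a, 'b) ring_scheme \<Rightarrow> nat \<Rightarrow> nat \<Rightarrow> nat \<Rightarrow> (nat \<Rightarrow> nat)
                      \<Rightarrow> (nat \<Rightarrow> nat \<Rightarrow> nat \<Rightarrow> 'a) \<Rightarrow> (nat \<Rightarrow> nat \<Rightarrow> 'a) \<Rightarrow> nat \<Rightarrow> 'a box_in" where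
  "sch_in R K B n w G X = restrict (\<lambda>p. if p = 0 then Inl w
       else Inr (chan_out R B n G X (p - 1), G (p - 1))) {..<Suc K}"

definition sch_out :: "nat \<Rightarrow> (nat \<Rightarrow> nat \<Rightarrow> 'a) \<Rightarrow> (nat \<Rightarrow> nat) \<Rightarrow> nat \<Rightarrow> 'a box_out" where
  "sch_out K X wh = restrict (\<lambda>p. if p = 0 then Inl X else Inr (wh (p - 1))) {..<Suc K}"

text \<open>Pr(What_k ~= W_k) under the joint law: uniform messages x box x channel
  (Y is a deterministic function of G and X, so it is summed out).\<close>
definition sch_err :: "('a, 'b) ring_scheme \<Rightarrow> nat \<Rightarrow> nat \<Rightarrow> (nat \<Rightarrow> nat \<Rightarrow> bool) \<Rightarrow> nat
                       \<Rightarrow> (nat \<Rightarrow> nat) \<Rightarrow> 'a scheme_box \<Rightarrow> nat \<Rightarrow> real" where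
  "sch_err R K B M n m P k =
     (\<Sum>w\<in>Wset K m. \<Sum>G\<in>Gset R K B M n. \<Sum>X\<in>Xset R n B. \<Sum>wh\<in>Wset K m.
        if wh k \<noteq> w k then P (sch_in R K B n w G X) (sch_out K X wh) else 0)
     / (real (card (Wset K m)) * real (card (Gset R K B M n)))"

text \<open>Rate tuple r (components r k, k<K): a sequence of schemes with vanishing max_k error
  (equivalently: each error vanishes, K being finite) and liminf (1/n) log2 |M_k| >= r k.\<close>
definition rate_achievable :: "('a, 'b) ring_scheme \<Rightarrow> nat \<Rightarrow> nat \<Rightarrow> (nat \<Rightarrow> nat \<Rightarrow> bool)
                               \<Rightarrow> (nat \<Rightarrow> real) \<Rightarrow> bool" where
  "rate_achievable R K B M r \<longleftrightarrow>
     (\<exists>ns ms (Ps :: nat \<Rightarrow> 'a scheme_box).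
        (\<forall>i. ns_scheme R K B (ns i) (ms i) (Ps i)) \<and>
        (\<forall>k<K. (\<lambda>i. sch_err R K B M (ns i) (ms i) (Ps i) k) \<longlonglongrightarrow> 0) \<and>
        (\<forall>k<K. ereal (r k) \<le> liminf (\<lambda>i. ereal (log 2 (real (ms i k)) / real (ns i)))))"

definition sum_cap :: "('a, 'b) ring_scheme \<Rightarrow> nat \<Rightarrow> nat \<Rightarrow> (nat \<Rightarrow> nat \<Rightarrow> bool) \<Rightarrow> real" where
  "sum_cap R K B M = Sup ((\<lambda>r. \<Sum>k<K. r k) ` closure {r. rate_achievable R K B M r})"

definition C_NS :: "nat \<Rightarrow> nat \<Rightarrow> (nat \<Rightarrow> nat \<Rightarrow> bool) \<Rightarrow> nat \<Rightarrow> real" where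
  "C_NS K B M q = sum_cap (fieldq q) K B M"

definition pp_filter :: "nat filter" where
  "pp_filter = inf sequentially (principal {q. primepow q})"

definition dof_achievable :: "nat \<Rightarrow> nat \<Rightarrow> (nat \<Rightarrow> nat \<Rightarrow> bool) \<Rightarrow> (nat \<Rightarrow> real) \<Rightarrow> bool" where
  "dof_achievable K B M d \<longleftrightarrow>
     (\<exists>Rt. (\<forall>q. primepow q \<longrightarrow> rate_achievable (fieldq q) K B M (Rt q)) \<and>
           (\<forall>k<K. ereal (d k) \<le> Liminf pp_filter (\<lambda>q. ereal (Rt q k / log 2 (real q)))))"

definition dof_sum :: "nat \<Rightarrow> nat \<Rightarrow> (nat \<Rightarrow> nat \<Rightarrow> bool) \<Rightarrow> real" where
  "dof_sum K B M = Sup ((\<lambda>d. \<Sum>k<K. d k) ` closure {d. dof_achievable K B M d})"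

end

theory Submission
  imports Defs "HOL-Algebra.Algebraic_Closure" "HOL-Number_Theory.Residues"
begin

text \<open>By no-signaling, the error probability of receiver k depends only on the box marginal of the
  transmitter and receiver k, hence only on the law of the k-th row of the channel. So the
  independent coefficients may be replaced by the columnwise rescaling of one fixed matrix of minimal
  rank r by random nonzero factors, which has the same rows in law, without changing any
  individual error probability. For each realisation of these factors, all receivers together
  see at most q^(r n) output tuples, and a no-signaling box then decodes all messages correctly
  with probability at most q^(r n) / (|M_1| ... |M_K|). The union bound over the
  receivers yields the claim on rates without any entropy inequality.\<close>

section \<open>Finite fields of prime power order\<close>

text \<open>The joint law of the receivers does not survive the change of channel: after rescaling,
  all rows share the same random factors and are in general dependent. Only quantities that involve
  one receiver carry over, so the errors are moved one receiver at a time and added afterwards. The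
  sharing is deliberate: common factors act as an invertible diagonal matrix, which can be absorbed
  into the channel input and leaves the rank of the fixed matrix in force at every use. A second
  obstacle is causality. The box inputs of the receivers depend on the box output \<open>X\<close>
  of the transmitter, whereas no-signaling compares fixed box inputs. Marginal identities are
  therefore used for each \<open>X\<close> separately, or after enlarging to a sum over all output
  tuples, which decouples the receivers' inputs from \<open>X\<close>. Finite fields enter because
  \<open>fieldq\<close> is a choice: nothing can be derived about it until some field on
  \<open>{..<q}\<close> is exhibited.\<close>

lemma (in cring) binomial_theorem:
  assumes x: "x \<in> carrier R" and y: "y \<in> carrier R"
  shows "(x \<oplus> y) [^] (n::nat) = (\<Oplus>i\<in>{..n}. [(n choose i)] \<cdot> (x [^] i \<otimes> y [^] (n - i)))"
proof (induction n)
  case 0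
  show ?case using x y by simp
next
  case (Suc n)
  define t where "t = (\<lambda>m i. [(m choose i)] \<cdot> (x [^] i \<otimes> y [^] (Suc n - i)))"
  have t: "t m i \<in> carrier R" for m i
    unfolding t_def using x y by auto
  define s where "s = (\<lambda>i. [(n choose i)] \<cdot> (x [^] i \<otimes> y [^] (n - i)))"
  have s: "s i \<in> carrier R" for i
    unfolding s_def using x y by auto
  define u where "u = (\<lambda>i. [(n choose i)] \<cdot> (x [^] Suc i \<otimes> y [^] (n - i)))"
  have u: "u i \<in> carrier R" for i
    unfolding u_def using x y by auto
  have sx: "x \<otimes> s i = u i" for i
  proof -
    have "x \<otimes> s i = [(n choose i)] \<cdot> (x \<otimes> (x [^] i \<otimes> y [^] (n - i)))"
      unfolding s_def using x y by (simp add: add_pow_rdistr)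
    also have "x \<otimes> (x [^] i \<otimes> y [^] (n - i)) = x [^] Suc i \<otimes> y [^] (n - i)"
      using x y by (simp add: m_ac)
    finally show ?thesis unfolding u_def .
  qed
  have sy: "y \<otimes> s i = t n i" if "i \<le> n" for i
  proof -
    have "y \<otimes> s i = [(n choose i)] \<cdot> (y \<otimes> (x [^] i \<otimes> y [^] (n - i)))"
      unfolding s_def using x y by (simp add: add_pow_rdistr)
    also have "y \<otimes> (x [^] i \<otimes> y [^] (n - i)) = x [^] i \<otimes> y [^] (Suc n - i)"
      using x y that by (simp add: m_ac Suc_diff_le)
    finally show ?thesis unfolding t_def .
  qed
  have tS: "t (Suc n) (Suc i) = u i \<oplus> t n (Suc i)" for i
    unfolding t_def u_def using x y by (simp add: add.nat_pow_mult)
  have tn: "t n (Suc n) = \<zero>" and t0: "t (Suc n) 0 = t n 0"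
    unfolding t_def by (simp_all add: binomial_eq_0)
  have "(x \<oplus> y) [^] Suc n = (x \<oplus> y) \<otimes> finsum R s {..n}"
    using Suc x y unfolding s_def by (simp add: m_comm)
  also have "\<dots> = x \<otimes> finsum R s {..n} \<oplus> y \<otimes> finsum R s {..n}"
    using x y s by (simp add: l_distr)
  also have "x \<otimes> finsum R s {..n} = finsum R u {..n}"
    using x s sx by (subst finsum_rdistr) auto
  also have "y \<otimes> finsum R s {..n} = finsum R (t n) {..n}"
    using y s t sy by (subst finsum_rdistr) (auto intro!: finsum_cong')
  also have "finsum R (t n) {..n} = finsum R (t n) {..Suc n}"
    using t tn by (subst finsum_Suc) auto
  also have "\<dots> = finsum R (\<lambda>i. t n (Suc i)) {..n} \<oplus> t n 0"
    using t by (subst finsum_Suc2) auto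
  also have "finsum R u {..n} \<oplus> (finsum R (\<lambda>i. t n (Suc i)) {..n} \<oplus> t n 0)
      = finsum R (\<lambda>i. t (Suc n) (Suc i)) {..n} \<oplus> t (Suc n) 0"
    unfolding tS t0 using t u by (subst finsum_addf) (auto simp: a_assoc)
  also have "\<dots> = finsum R (t (Suc n)) {..Suc n}"
    using t by (subst finsum_Suc2) auto
  finally show ?case unfolding t_def .
qed

section \<open>Positive characteristic and the Frobenius map\<close>

lemma (in cring) add_pow_char_dvd:
  assumes "[p] \<cdot> \<one> = \<zero>" "p dvd n" "x \<in> carrier R"
  shows "[(n::nat)] \<cdot> x = \<zero>"
proof -
  obtain k where n: "n = p * k" using assms(2) by blast
  have "[p] \<cdot> x = [p] \<cdot> \<one> \<otimes> x"
    using assms(3) by (simp add: add_pow_ldistr)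
  hence "[p] \<cdot> x = \<zero>" using assms by simp
  moreover have "[n] \<cdot> x = [k] \<cdot> ([p] \<cdot> x)"
    unfolding n using assms(3) by (simp add: add.nat_pow_pow)
  ultimately show ?thesis by simp
qed

lemma (in cring) frobenius_add:
  assumes p: "Factorial_Ring.prime (p::nat)" and ch: "[p] \<cdot> \<one> = \<zero>"
    and x: "x \<in> carrier R" and y: "y \<in> carrier R"
  shows "(x \<oplus> y) [^] p = x [^] p \<oplus> y [^] p"
proof -
  obtain n where n: "p = Suc n" using p prime_gt_0_nat[of p] gr0_implies_Suc by blast
  define t where "t = (\<lambda>i. [(p choose i)] \<cdot> (x [^] i \<otimes> y [^] (p - i)))"
  have t: "t i \<in> carrier R" for i
    unfolding t_def using x y by auto
  have mid: "t i = \<zero>" if "i \<in> {..<p} - {0}" for i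
    unfolding t_def using that p x y
    by (intro add_pow_char_dvd[OF ch] dvd_choose_prime) auto
  have "(x \<oplus> y) [^] p = finsum R t {..Suc n}"
    unfolding binomial_theorem[OF x y] t_def n ..
  also have "\<dots> = t p \<oplus> finsum R t {..n}"
    using t n by (subst finsum_Suc) auto
  also have "finsum R t {..n} = finsum R t {0}"
    using mid t n by (intro add.finprod_mono_neutral_cong_right) auto
  also have "\<dots> = t 0" using t by simp
  also have "t p \<oplus> t 0 = x [^] p \<oplus> y [^] p"
    unfolding t_def using x y by simp
  finally show ?thesis .
qed

lemma (in cring) frobenius_power_add:
  assumes "Factorial_Ring.prime (p::nat)" "[p] \<cdot> \<one> = \<zero>" "x \<in> carrier R" "y \<in> carrier R"
  shows "(x \<oplus> y) [^] (p ^ k) = x [^] (p ^ k) \<oplus> y [^] (p ^ k)"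
proof (induction k)
  case 0
  show ?case using assms by simp
next
  case (Suc k)
  have "z [^] (p ^ Suc k) = (z [^] (p ^ k)) [^] p" if "z \<in> carrier R" for z
    using that by (simp add: nat_pow_pow mult.commute)
  thus ?case using Suc assms by (simp add: frobenius_add)
qed

text \<open>A substitute for the formal derivative: if \<open>h\<close> evaluates polynomials at a
  point and \<open>y\<close> is that point as a constant, the cofactor \<open>z\<close> takes the
  value \<open>n * a^(n-1)\<close> there. The extra factor \<open>h y\<close> avoids the exponent
  \<open>n - 1\<close>.\<close>

lemma (in ring_hom_cring) pow_diff_factor:
  assumes x: "x \<in> carrier R" and y: "y \<in> carrier R" and xy: "h x = h y"
  shows "\<exists>z\<in>carrier R. x [^] (n::nat) \<ominus> y [^] n = (x \<ominus> y) \<otimes> z \<and>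
    h y \<otimes>\<^bsub>S\<^esub> h z = [n] \<cdot>\<^bsub>S\<^esub> (h y [^]\<^bsub>S\<^esub> n)"
proof (induction n)
  case 0
  show ?case
    using x y by (intro bexI[of _ \<zero>]) auto
next
  case (Suc n)
  then obtain z where z: "z \<in> carrier R" "x [^] n \<ominus> y [^] n = (x \<ominus> y) \<otimes> z"
    and ev: "h y \<otimes>\<^bsub>S\<^esub> h z = [n] \<cdot>\<^bsub>S\<^esub> (h y [^]\<^bsub>S\<^esub> n)" by blast
  have xn: "x [^] n \<in> carrier R" "y [^] n \<in> carrier R" using x y by auto
  have "x [^] Suc n \<ominus> y [^] Suc n = (x \<ominus> y) \<otimes> x [^] n \<oplus> y \<otimes> (x [^] n \<ominus> y [^] n)"
    unfolding R.nat_pow_Suc using x y xn by algebra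
  also have "\<dots> = (x \<ominus> y) \<otimes> (x [^] n \<oplus> y \<otimes> z)"
    unfolding z(2) using x y xn z(1) by algebra
  finally have eq: "x [^] Suc n \<ominus> y [^] Suc n = (x \<ominus> y) \<otimes> (x [^] n \<oplus> y \<otimes> z)" .
  have c: "h y \<in> carrier S" "h z \<in> carrier S" using y z by auto
  have "h y \<otimes>\<^bsub>S\<^esub> h (x [^] n \<oplus> y \<otimes> z) = h y \<otimes>\<^bsub>S\<^esub> (h y [^]\<^bsub>S\<^esub> n \<oplus>\<^bsub>S\<^esub> h y \<otimes>\<^bsub>S\<^esub> h z)"
    using x y z(1) xn xy by simp
  also have "\<dots> = h y \<otimes>\<^bsub>S\<^esub> (h y [^]\<^bsub>S\<^esub> n \<oplus>\<^bsub>S\<^esub> [n] \<cdot>\<^bsub>S\<^esub> (h y [^]\<^bsub>S\<^esub> n))"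
    unfolding ev ..
  also have "\<dots> = h y [^]\<^bsub>S\<^esub> Suc n \<oplus>\<^bsub>S\<^esub> [n] \<cdot>\<^bsub>S\<^esub> (h y [^]\<^bsub>S\<^esub> Suc n)"
    using c by (simp add: S.r_distr S.add_pow_rdistr S.m_comm)
  also have "\<dots> = [(Suc n)] \<cdot>\<^bsub>S\<^esub> (h y [^]\<^bsub>S\<^esub> Suc n)"
    using c by (simp add: S.a_comm)
  finally show ?case using x y xn z eq by (intro bexI[of _ "x [^] n \<oplus> y \<otimes> z"]) auto
qed
text \<open>Over an algebraically closed field \<open>X^N - 1\<close> has \<open>N\<close> roots
  with multiplicity, so it remains to exclude double roots. At a double root the cofactor of
  \<open>X - a\<close> would vanish, but \<open>pow_diff_factor\<close> makes \<open>a\<close> times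
  its value equal to \<open>N\<close>, which is nonzero by \<open>sep\<close>.\<close>

lemma (in algebraically_closed) card_roots_of_unity:
  assumes N: "0 < N" and sep: "[N] \<cdot>\<^bsub>L\<^esub> \<one>\<^bsub>L\<^esub> \<noteq> \<zero>\<^bsub>L\<^esub>"
  shows "card {a \<in> carrier L. a [^]\<^bsub>L\<^esub> (N::nat) = \<one>\<^bsub>L\<^esub>} = N"
    and "finite {a \<in> carrier L. a [^]\<^bsub>L\<^esub> (N::nat) = \<one>\<^bsub>L\<^esub>}"
proof -
  let ?P = "poly_ring L"
  interpret UP: domain ?P
    using univ_poly_is_domain[OF carrier_is_subring] .
  define f where "f = X\<^bsub>L\<^esub> [^]\<^bsub>?P\<^esub> N \<ominus>\<^bsub>?P\<^esub> \<one>\<^bsub>?P\<^esub>"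
  have X: "X\<^bsub>L\<^esub> \<in> carrier ?P" using var_closed(1)[OF carrier_is_subring] .
  have f: "f \<in> carrier ?P" unfolding f_def using X by auto
  have X1: "X\<^bsub>L\<^esub> [^]\<^bsub>?P\<^esub> N = monom \<one> N"
    using unitary_monom_eq_var_pow[OF carrier_is_subring] by simp
  have m1: "\<ominus>\<^bsub>?P\<^esub> \<one>\<^bsub>?P\<^esub> \<in> carrier ?P" by auto
  have d1: "degree (\<ominus>\<^bsub>?P\<^esub> \<one>\<^bsub>?P\<^esub>) = 0"
    using univ_poly_a_inv_degree[OF carrier_is_subring UP.one_closed] by (simp add: univ_poly_one)
  have dN: "degree (monom \<one> N) = N" unfolding monom_def by simp
  have deg: "degree f = N"
  proof -
    have "degree (poly_add (monom \<one> N) (\<ominus>\<^bsub>?P\<^esub> \<one>\<^bsub>?P\<^esub>)) = max N 0"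
      using poly_add_degree_eq[OF carrier_is_subring, of "monom \<one> N" "\<ominus>\<^bsub>?P\<^esub> \<one>\<^bsub>?P\<^esub>"] m1 d1 dN N
        X1 UP.nat_pow_closed[OF X, of N] unfolding univ_poly_carrier by auto
    thus ?thesis unfolding f_def X1 a_minus_def univ_poly_add by simp
  qed
  have f0: "f \<noteq> []" using deg N by auto
  have hom: "(\<lambda>p. eval p a) \<in> ring_hom ?P L" if "a \<in> carrier L" for a
    using eval_is_hom[OF carrier_is_subring that] .
  have evf: "eval f a = a [^] N \<ominus> \<one>" if a: "a \<in> carrier L" for a
  proof -
    interpret E: ring_hom_cring ?P L "\<lambda>p. eval p a"
      using hom[OF a] UP.is_cring is_cring by (simp add: ring_hom_cring_def ring_hom_cring_axioms_def)
    show ?thesis unfolding f_def using X eval_var[OF a] by (simp add: a_minus_def)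
  qed
  have root: "is_root f a \<longleftrightarrow> a \<in> carrier L \<and> a [^] N = \<one>" for a
    unfolding is_root_def using evf f0 by auto
  have simple: "alg_mult f a \<le> 1" if a: "is_root f a" for a
  proof (rule ccontr)
    assume "\<not> alg_mult f a \<le> 1"
    hence 2: "2 \<le> alg_mult f a" by simp
    have ac: "a \<in> carrier L" and aN: "a [^] N = \<one>" using a root by auto
    let ?b = "[\<one>, \<ominus> a]"
    have b: "?b \<in> carrier ?P"
      unfolding sym[OF univ_poly_carrier] polynomial_def using ac by auto
    interpret E: ring_hom_cring ?P L "\<lambda>p. eval p a"
      using hom[OF ac] UP.is_cring is_cring by (simp add: ring_hom_cring_def ring_hom_cring_axioms_def)
    have eb: "eval ?b a = \<zero>" using ac by (simp add: r_neg)
    \<comment> \<open>Since \<open>a^N = 1\<close>, the constant polynomial \<open>c\<close> turns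
      \<open>f\<close> into \<open>X^N - c^N\<close>, the shape that \<open>pow_diff_factor\<close>
      factors.\<close>
    define c where "c = poly_of_const a"
    have chom: "poly_of_const \<in> ring_hom L ?P"
      using canonical_embedding_is_hom[OF carrier_is_subring] by simp
    interpret C: ring_hom_cring L ?P poly_of_const
      using chom UP.is_cring is_cring by (simp add: ring_hom_cring_def ring_hom_cring_axioms_def)
    have c: "c \<in> carrier ?P" unfolding c_def using ac by auto
    have a0: "a \<noteq> \<zero>" using aN N by (auto simp: nat_pow_zero)
    have c_list: "c = [a]" unfolding c_def poly_of_const_def using a0 by simp
    have "?b \<oplus>\<^bsub>?P\<^esub> c = X\<^bsub>L\<^esub>"
      unfolding c_list univ_poly_add var_def using ac by (simp add: l_neg)
    hence cX: "X\<^bsub>L\<^esub> \<ominus>\<^bsub>?P\<^esub> c = ?b"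
      using X b c by (metis UP.add.inv_solve_right UP.minus_eq)
    have ec: "eval c a = a" unfolding c_list using ac by simp
    have cN: "c [^]\<^bsub>?P\<^esub> N = \<one>\<^bsub>?P\<^esub>"
      unfolding c_def using C.hom_pow[OF ac, of N] aN by simp
    \<comment> \<open>A double root yields a factorisation through \<open>?b\<close> squared.
      Cancelling one \<open>?b\<close> against the factorisation with cofactor \<open>h\<close>
      below shows that \<open>?b\<close> divides \<open>h\<close>.\<close>
    obtain g where g: "g \<in> carrier ?P" and fg: "f = ?b [^]\<^bsub>?P\<^esub> (2::nat) \<otimes>\<^bsub>?P\<^esub> g"
      using le_alg_mult_imp_pdivides[OF ac f 2] unfolding pdivides_def by auto
    have "eval X\<^bsub>L\<^esub> a = eval c a" using eval_var[OF ac] ec by simp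
    then obtain h where h: "h \<in> carrier ?P" "f = ?b \<otimes>\<^bsub>?P\<^esub> h"
      and eh: "eval c a \<otimes> eval h a = [N] \<cdot> (eval c a [^] N)"
      using E.pow_diff_factor[OF X c, of N] unfolding cX cN f_def by blast
    have "?b \<otimes>\<^bsub>?P\<^esub> h = ?b \<otimes>\<^bsub>?P\<^esub> (?b \<otimes>\<^bsub>?P\<^esub> g)"
      using fg h(2) b g by (simp add: numeral_2_eq_2 UP.m_assoc)
    moreover have "?b \<noteq> \<zero>\<^bsub>?P\<^esub>" by (simp add: univ_poly_zero)
    ultimately have "h = ?b \<otimes>\<^bsub>?P\<^esub> g"
      using UP.m_lcancel[of ?b h "?b \<otimes>\<^bsub>?P\<^esub> g"] b h(1) g by auto
    hence "eval h a = eval ?b a \<otimes> eval g a"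
      using E.hom_mult[OF b g] by simp
    hence "eval h a = \<zero>" using eb E.hom_closed[OF g] by (simp del: eval.simps)
    thus False using eh sep ec ac aN by simp
  qed
  have setm: "set_mset (roots f) = {a \<in> carrier L. a [^] N = \<one>}"
    using roots_mem_iff_is_root[OF f] root by auto
  show "finite {a \<in> carrier L. a [^] N = \<one>}"
    unfolding setm[symmetric] by simp
  have "size (roots f) = N"
    using roots_over_carrier[OF f] deg unfolding splitted_def by simp
  moreover have "size (roots f) = card (set_mset (roots f))"
  proof -
    have "count (roots f) a = 1" if "a \<in># roots f" for a
      using simple[of a] that roots_mem_iff_is_root[OF f] alg_mult_eq_count_roots[OF f]
      by (metis Suc_leI count_greater_zero_iff le_antisym One_nat_def)
    thus ?thesis by (simp add: size_multiset_overloaded_eq)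
  qed
  ultimately show "card {a \<in> carrier L. a [^] N = \<one>} = N"
    unfolding setm by simp
qed

text \<open>The subfield is the fixed set of the \<open>k\<close>-fold Frobenius map: additivity of
  that map gives closure under sums, and the nonzero fixed points are exactly the roots of unity of
  order dividing \<open>p^k - 1\<close>, which are counted above.\<close>

lemma (in algebraically_closed) ex_finite_subfield:
  assumes p: "Factorial_Ring.prime (p::nat)" and ch: "[p] \<cdot>\<^bsub>L\<^esub> \<one>\<^bsub>L\<^esub> = \<zero>\<^bsub>L\<^esub>" and k: "0 < k"
  shows "\<exists>S. subfield S L \<and> finite S \<and> card S = p ^ k"
proof -
  define N where "N = p ^ k - 1"
  have p1: "1 < p ^ k" using p k prime_gt_1_nat one_less_power by blast
  hence N: "0 < N" "p ^ k = Suc N" unfolding N_def by auto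
  \<comment> \<open>In characteristic \<open>p\<close> the number \<open>N = p^k - 1\<close> equals
    \<open>-1\<close>, hence is nonzero; this is the separability condition of the root
    count.\<close>
  have add1: "[N] \<cdot> \<one> \<oplus> \<one> = \<zero>"
  proof -
    have "[(p ^ k)] \<cdot> \<one> = \<zero>" using add_pow_char_dvd[OF ch, of "p ^ k" \<one>] k by auto
    thus ?thesis unfolding N(2) by simp
  qed
  hence sep: "[N] \<cdot> \<one> \<noteq> \<zero>" by auto
  define T where "T = {a \<in> carrier L. a [^] N = \<one>}"
  define S where "S = {a \<in> carrier L. a [^] (p ^ k) = a}"
  have ST: "S = insert \<zero> T"
  proof (rule Set.set_eqI)
    fix a
    show "a \<in> S \<longleftrightarrow> a \<in> insert \<zero> T"
    proof (cases "a \<in> carrier L - {\<zero>}")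
      case True
      hence "a [^] N \<otimes> a = a \<longleftrightarrow> a [^] N = \<one>"
        using m_rcancel[of a "a [^] N" \<one>] by auto
      thus ?thesis using True unfolding S_def T_def N(2) by auto
    next
      case False
      thus ?thesis unfolding S_def T_def N(2) by auto
    qed
  qed
  have T0: "\<zero> \<notin> T" unfolding T_def using N by (auto simp: nat_pow_zero)
  have "subring S L"
  proof (rule subringI)
    show "S \<subseteq> carrier L" "\<one> \<in> S" unfolding S_def by auto
  next
    fix x y assume xy: "x \<in> S" "y \<in> S"
    thus "x \<otimes> y \<in> S" unfolding S_def by (auto simp: nat_pow_distrib)
    show "x \<oplus> y \<in> S" using xy frobenius_power_add[OF p ch, of x y k] unfolding S_def by auto
  next
    fix x assume x: "x \<in> S"
    \<comment> \<open>Uniqueness of additive inverses treats \<open>p = 2\<close> and odd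
      \<open>p\<close> alike, without a sign rule for powers.\<close>
    have "x [^] (p ^ k) \<oplus> (\<ominus> x) [^] (p ^ k) = (x \<oplus> \<ominus> x) [^] (p ^ k)"
      using x frobenius_power_add[OF p ch, of x "\<ominus> x" k] unfolding S_def by auto
    also have "\<dots> = \<zero>" using x unfolding S_def N(2) by (auto simp: r_neg)
    finally have "(\<ominus> x) [^] (p ^ k) = \<ominus> x"
      using x unfolding S_def by (metis (mono_tags, lifting) a_comm a_inv_closed mem_Collect_eq minus_equality nat_pow_closed)
    thus "\<ominus> x \<in> S" using x unfolding S_def by auto
  qed
  moreover have "inv x \<in> S" if x: "x \<in> S - {\<zero>}" for x
  proof -
    have xu: "x \<in> Units L" "x \<in> carrier L" "x [^] (p ^ k) = x" using x field_Units unfolding S_def by auto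
    have "inv x [^] (p ^ k) \<otimes> x [^] (p ^ k) = (inv x \<otimes> x) [^] (p ^ k)"
      using xu by (intro nat_pow_distrib[symmetric]) auto
    hence "inv x [^] (p ^ k) \<otimes> x = \<one>" using xu by simp
    hence "inv x [^] (p ^ k) = inv x" using xu by (metis Units_inv_closed comm_inv_char m_comm nat_pow_closed)
    thus ?thesis using xu unfolding S_def by auto
  qed
  ultimately have "subfield S L" by (rule subfieldI')
  moreover have "finite S" "card S = p ^ k"
    unfolding ST using card_roots_of_unity[OF N(1) sep] T0 N unfolding T_def by auto
  ultimately show ?thesis by blast
qed

text \<open>The embedding \<open>indexed_const\<close> into an algebraic closure carries the
  relation \<open>p = 0\<close> along. Applied to the residues modulo \<open>p\<close>, it supplies
  the closed field in which the field of order \<open>p^k\<close> is found.\<close>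

lemma (in field) ex_closed_extension_same_char:
  assumes "[(p::nat)] \<cdot> \<one> = \<zero>"
  shows "\<exists>L :: (('a list \<times> nat) multiset \<Rightarrow> 'a) ring.
    algebraically_closed L \<and> [p] \<cdot>\<^bsub>L\<^esub> \<one>\<^bsub>L\<^esub> = \<zero>\<^bsub>L\<^esub>"
proof -
  obtain L :: "(('a list \<times> nat) multiset \<Rightarrow> 'a) ring"
    where L: "algebraic_closure L (indexed_const ` carrier R)"
      and hom: "indexed_const \<in> ring_hom R L"
    by (rule exists_closure)
  interpret L: algebraic_closure L "indexed_const ` carrier R" by (rule L)
  have "ring_hom_cring R L indexed_const"
    using hom L.is_cring by (simp add: ring_hom_cring_def ring_hom_cring_axioms_def is_cring)
  then interpret I: ring_hom_cring R L indexed_const .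
  have "indexed_const ([n] \<cdot> \<one>) = [n] \<cdot>\<^bsub>L\<^esub> \<one>\<^bsub>L\<^esub>" for n :: nat
    by (induction n) simp_all
  from this[of p] have "[p] \<cdot>\<^bsub>L\<^esub> \<one>\<^bsub>L\<^esub> = \<zero>\<^bsub>L\<^esub>"
    using assms by simp
  thus ?thesis using L.algebraically_closed_axioms by blast
qed

lemma residue_ring_char:
  assumes "Factorial_Ring.prime (p::nat)"
  shows "field (residue_ring (int p))"
    and "[p] \<cdot>\<^bsub>residue_ring (int p)\<^esub> \<one>\<^bsub>residue_ring (int p)\<^esub> = \<zero>\<^bsub>residue_ring (int p)\<^esub>"
proof -
  interpret F: residues_prime p "residue_ring (int p)"
    using assms by (simp add: residues_prime_def)
  show "field (residue_ring (int p))" by (rule F.is_field)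
  interpret F': field "residue_ring (int p)" by (rule F.is_field)
  have "[n] \<cdot>\<^bsub>residue_ring (int p)\<^esub> \<one>\<^bsub>residue_ring (int p)\<^esub> = int n mod int p" for n :: nat
  proof (induction n)
    case 0
    show ?case by (simp add: F.res_zero_eq)
  next
    case (Suc n)
    have "[(Suc n)] \<cdot>\<^bsub>residue_ring (int p)\<^esub> \<one>\<^bsub>residue_ring (int p)\<^esub> = (int n mod int p + 1) mod int p"
      using Suc by (simp add: F.res_add_eq F.res_one_eq)
    also have "\<dots> = int (Suc n) mod int p" by (simp add: mod_add_right_eq add.commute)
    finally show ?case .
  qed
  from this[of p] show "[p] \<cdot>\<^bsub>residue_ring (int p)\<^esub> \<one>\<^bsub>residue_ring (int p)\<^esub> = \<zero>\<^bsub>residue_ring (int p)\<^esub>"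
    by (simp add: F.res_zero_eq)
qed

text \<open>The finite subfield of the closure is moved to the carrier \<open>{..<q}\<close> along
  an arbitrary bijection. This discharges the existence claim behind the choice in
  \<open>fieldq\<close>.\<close>

lemma ex_field_of_order:
  assumes "primepow q"
  shows "\<exists>R :: nat ring. field R \<and> carrier R = {..<q}"
proof -
  obtain p k where p: "Factorial_Ring.prime (p::nat)" and k: "0 < k" and q: "q = p ^ k"
    using assms unfolding primepow_def by auto
  obtain L :: "((int list \<times> nat) multiset \<Rightarrow> int) ring"
    where L: "algebraically_closed L" and ch: "[p] \<cdot>\<^bsub>L\<^esub> \<one>\<^bsub>L\<^esub> = \<zero>\<^bsub>L\<^esub>"
    using field.ex_closed_extension_same_char[OF residue_ring_char[OF p]] by blast
  interpret L: algebraically_closed L by (rule L)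
  obtain S where S: "subfield S L" "finite S" "card S = q"
    using L.ex_finite_subfield[OF p ch k] q by blast
  interpret S: field "L\<lparr>carrier := S\<rparr>"
    using L.subfield_iff(2)[OF S(1)] .
  obtain h where h: "bij_betw h S {..<q}"
    using ex_bij_betw_finite_nat[OF S(2)] S(3) by (auto simp: atLeast0LessThan)
  have "field (image_ring h (L\<lparr>carrier := S\<rparr>))"
    using S.inj_imp_image_ring_is_field h unfolding bij_betw_def by auto
  moreover have "carrier (image_ring h (L\<lparr>carrier := S\<rparr>)) = {..<q}"
    unfolding image_ring_carrier using h unfolding bij_betw_def by auto
  ultimately show ?thesis by blast
qed

lemma fieldq_is_field:
  assumes "primepow q"
  shows "field (fieldq q)" "carrier (fieldq q) = {..<q}"
  using someI_ex[OF ex_field_of_order[OF assms]] unfolding fieldq_def by auto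

section \<open>Rank and minimal rank\<close>

lemma (in abelian_monoid) finsum_swap:
  assumes "finite A" "finite B" "\<And>i j. i \<in> A \<Longrightarrow> j \<in> B \<Longrightarrow> f i j \<in> carrier G"
  shows "(\<Oplus>i\<in>A. \<Oplus>j\<in>B. f i j) = (\<Oplus>j\<in>B. \<Oplus>i\<in>A. f i j)"
  using assms(1,3)
proof (induction A rule: finite_induct)
  case empty
  show ?case by simp
next
  case (insert a A)
  have "(\<Oplus>i\<in>insert a A. \<Oplus>j\<in>B. f i j) = (\<Oplus>j\<in>B. f a j) \<oplus> (\<Oplus>j\<in>B. \<Oplus>i\<in>A. f i j)"
    using insert by (subst finsum_insert) auto
  also have "\<dots> = (\<Oplus>j\<in>B. f a j \<oplus> (\<Oplus>i\<in>A. f i j))"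
    using insert by (subst finsum_addf) auto
  also have "\<dots> = (\<Oplus>j\<in>B. \<Oplus>i\<in>insert a A. f i j)"
    using insert by (intro finsum_cong') auto
  finally show ?case .
qed

text \<open>Row \<open>k\<close> is a linear combination of the rows in \<open>S\<close>, so the
  product of row \<open>k\<close> with a vector is determined by the products of those rows. Stating
  this for outputs is the only form in which rank is used later.\<close>

lemma (in field) dependent_row_determined:
  assumes S: "finite S" "rows_indep R B G S" and k: "k \<notin> S" "\<not> rows_indep R B G (insert k S)"
    and G: "\<And>i j. i \<in> insert k S \<Longrightarrow> j < B \<Longrightarrow> G i j \<in> carrier R"
    and z: "\<And>j. j < B \<Longrightarrow> z j \<in> carrier R" and z': "\<And>j. j < B \<Longrightarrow> z' j \<in> carrier R"
    and eq: "\<And>i. i \<in> S \<Longrightarrow> (\<Oplus>j\<in>{..<B}. G i j \<otimes> z j) = (\<Oplus>j\<in>{..<B}. G i j \<otimes> z' j)"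
  shows "(\<Oplus>j\<in>{..<B}. G k j \<otimes> z j) = (\<Oplus>j\<in>{..<B}. G k j \<otimes> z' j)"
proof -
  obtain c where c: "c \<in> insert k S \<rightarrow> carrier R"
    and dep: "\<And>j. j < B \<Longrightarrow> (\<Oplus>i\<in>insert k S. c i \<otimes> G i j) = \<zero>"
    and nz: "\<exists>i\<in>insert k S. c i \<noteq> \<zero>"
    using k(2) unfolding rows_indep_def by blast
  have cc: "c i \<in> carrier R" if "i \<in> insert k S" for i using c that by auto
  \<comment> \<open>With a zero coefficient at \<open>k\<close> the relation would be one among the
    independent rows \<open>S\<close> alone.\<close>
  have ck: "c k \<noteq> \<zero>"
  proof
    assume ck: "c k = \<zero>"
    have "(\<Oplus>i\<in>S. c i \<otimes> G i j) = \<zero>" if j: "j < B" for j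
    proof -
      have "(\<Oplus>i\<in>insert k S. c i \<otimes> G i j) = c k \<otimes> G k j \<oplus> (\<Oplus>i\<in>S. c i \<otimes> G i j)"
        using S k cc G j by (intro finsum_insert) auto
      moreover have "(\<Oplus>i\<in>S. c i \<otimes> G i j) \<in> carrier R"
        using cc G j by (intro finsum_closed) auto
      ultimately show ?thesis using dep[OF j] ck G j by simp
    qed
    hence "\<forall>i\<in>S. c i = \<zero>" using S(2) c unfolding rows_indep_def by auto
    thus False using nz ck by auto
  qed
  \<comment> \<open>The relation among rows is applied to a vector \<open>v\<close> by exchanging
    the two sums.\<close>
  have comb: "(\<Oplus>i\<in>insert k S. c i \<otimes> (\<Oplus>j\<in>{..<B}. G i j \<otimes> v j)) = \<zero>"
    if v: "\<And>j. j < B \<Longrightarrow> v j \<in> carrier R" for v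
  proof -
    have "(\<Oplus>i\<in>insert k S. c i \<otimes> (\<Oplus>j\<in>{..<B}. G i j \<otimes> v j))
        = (\<Oplus>i\<in>insert k S. \<Oplus>j\<in>{..<B}. c i \<otimes> G i j \<otimes> v j)"
      using cc G v by (intro finsum_cong') (auto simp: finsum_rdistr m_assoc Pi_def intro!: finsum_cong')
    also have "\<dots> = (\<Oplus>j\<in>{..<B}. \<Oplus>i\<in>insert k S. c i \<otimes> G i j \<otimes> v j)"
      using S cc G v by (intro finsum_swap) auto
    also have "\<dots> = (\<Oplus>j\<in>{..<B}. (\<Oplus>i\<in>insert k S. c i \<otimes> G i j) \<otimes> v j)"
      using cc G v S by (intro finsum_cong' finsum_ldistr[symmetric]) auto
    also have "\<dots> = (\<Oplus>j\<in>{..<B}. \<zero>)"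
      using dep v by (intro finsum_cong') auto
    finally show ?thesis by simp
  qed
  define y where "y = (\<lambda>i. \<Oplus>j\<in>{..<B}. G i j \<otimes> z j)"
  define y' where "y' = (\<lambda>i. \<Oplus>j\<in>{..<B}. G i j \<otimes> z' j)"
  have yc: "y i \<in> carrier R" "y' i \<in> carrier R" if "i \<in> insert k S" for i
    unfolding y_def y'_def using G z z' that by (auto intro!: finsum_closed)
  define s where "s = (\<Oplus>i\<in>S. c i \<otimes> y i)"
  have s': "(\<Oplus>i\<in>S. c i \<otimes> y' i) = s"
    unfolding s_def
  proof (rule finsum_cong')
    fix i assume i: "i \<in> S"
    show "c i \<otimes> y' i = c i \<otimes> y i" unfolding y_def y'_def eq[OF i] ..
  qed (use cc yc in auto)
  have sc: "s \<in> carrier R" unfolding s_def using cc yc by (intro finsum_closed) auto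
  have "c k \<otimes> y k \<oplus> s = (\<Oplus>i\<in>insert k S. c i \<otimes> y i)"
    unfolding s_def using S k cc yc by (intro finsum_insert[symmetric]) auto
  also have "\<dots> = \<zero>" unfolding y_def by (rule comb) (rule z)
  finally have 1: "c k \<otimes> y k \<oplus> s = \<zero>" .
  have "c k \<otimes> y' k \<oplus> s = (\<Oplus>i\<in>insert k S. c i \<otimes> y' i)"
    unfolding s'[symmetric] using S k cc yc by (intro finsum_insert[symmetric]) auto
  also have "\<dots> = \<zero>" unfolding y'_def by (rule comb) (rule z')
  finally have 2: "c k \<otimes> y' k \<oplus> s = \<zero>" .
  have "c k \<otimes> y k = c k \<otimes> y' k"
    using 1 2 sc cc yc by (metis add.right_cancel insertI1 m_closed)
  hence "y k = y' k" using ck cc yc m_lcancel[of "c k" "y k" "y' k"] by auto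
  thus ?thesis unfolding y_def y'_def .
qed

text \<open>A set attaining the maximal cardinality in \<open>mat_rank\<close> is also maximal for
  inclusion. The maximum is attained because the empty set of rows is independent.\<close>

lemma ex_maximal_indep_rows:
  "\<exists>S\<subseteq>{..<K}. rows_indep R B G S \<and> card S = mat_rank R K B G \<and>
    (\<forall>k<K. k \<notin> S \<longrightarrow> \<not> rows_indep R B G (insert k S))"
proof -
  let ?C = "{card S | S. S \<subseteq> {..<K} \<and> rows_indep R B G S}"
  have fin: "finite ?C" by (rule finite_subset[of _ "card ` Pow {..<K}"]) auto
  have "rows_indep R B G {}" unfolding rows_indep_def by auto
  hence "?C \<noteq> {}" by blast
  from Max_in[OF fin this] obtain S where S: "S \<subseteq> {..<K}" "rows_indep R B G S" "card S = Max ?C"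
    by auto
  have "\<not> rows_indep R B G (insert k S)" if k: "k < K" "k \<notin> S" for k
  proof
    assume "rows_indep R B G (insert k S)"
    hence "card (insert k S) \<in> ?C" using S k by blast
    hence "card (insert k S) \<le> card S" using Max_ge[OF fin] S(3) by auto
    thus False using k S(1) finite_subset[OF S(1)] by auto
  qed
  thus ?thesis
    using S unfolding mat_rank_def by (intro exI[of _ S]) auto
qed

lemma mat_rank_le: "mat_rank R K B G \<le> K"
proof -
  obtain S where "S \<subseteq> {..<K}" "card S = mat_rank R K B G"
    using ex_maximal_indep_rows[of K R B G] by metis
  thus ?thesis using card_mono[of "{..<K}" S] by auto
qed

text \<open>The admissible \<open>G\<close> are functions on all pairs of naturals, so there are
  infinitely many; finiteness of the set of ranks comes from the bound by \<open>K\<close>, and the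
  zero-one pattern of \<open>M\<close> shows that it is nonempty.\<close>

lemma (in field) ex_minrk_matrix:
  "\<exists>G. (\<forall>i<K. \<forall>j<B. G i j \<in> carrier R \<and> (G i j = \<zero> \<longleftrightarrow> \<not> M i j)) \<and>
    mat_rank R K B G = minrk R K B M"
proof -
  let ?ok = "\<lambda>G. \<forall>i<K. \<forall>j<B. G i j \<in> carrier R \<and> (G i j = \<zero> \<longleftrightarrow> \<not> M i j)"
  let ?C = "{mat_rank R K B G | G. ?ok G}"
  have fin: "finite ?C" by (rule finite_subset[of _ "{..K}"]) (auto simp: mat_rank_le)
  have "?ok (\<lambda>i j. if M i j then \<one> else \<zero>)" by auto
  hence "mat_rank R K B (\<lambda>i j. if M i j then \<one> else \<zero>) \<in> ?C"
    by (intro CollectI exI[of _ "\<lambda>i j. if M i j then \<one> else \<zero>"] conjI refl)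
  hence "?C \<noteq> {}" by (rule ex_in_conv[THEN iffD1, OF exI])
  from Min_in[OF fin this] obtain G where G: "?ok G" "mat_rank R K B G = Min ?C"
    unfolding mem_Collect_eq by metis
  thus ?thesis
    unfolding minrk_def by (intro exI[of _ G] conjI) simp_all
qed

section \<open>Rescaled channel coefficients\<close>

text \<open>Two roles: with \<open>m\<close> a row of the connectivity matrix these are the
  coefficient sequences of one receiver, and with \<open>m\<close> constantly true they form the
  group of nonzero scaling factors. Here \<open>m\<close> is a mask, not a vector of message
  sizes.\<close>

definition row_set :: "('a, 'b) ring_scheme \<Rightarrow> nat \<Rightarrow> nat \<Rightarrow> (nat \<Rightarrow> bool) \<Rightarrow> (nat \<Rightarrow> nat \<Rightarrow> 'a) set" where
  "row_set R B n m = PiE {..<n} (\<lambda>\<tau>. PiE {..<B}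
     (\<lambda>j. if m j then carrier R - {zero R} else {zero R}))"

definition row_scale :: "('a, 'b) ring_scheme \<Rightarrow> nat \<Rightarrow> nat \<Rightarrow> (nat \<Rightarrow> nat \<Rightarrow> 'a) \<Rightarrow> (nat \<Rightarrow> nat \<Rightarrow> 'a)
    \<Rightarrow> nat \<Rightarrow> nat \<Rightarrow> 'a" where
  "row_scale R B n A D = (\<lambda>\<tau>\<in>{..<n}. \<lambda>j\<in>{..<B}. mult R (A \<tau> j) (D \<tau> j))"

text \<open>One \<open>D\<close> serves all receivers, so at each use the whole matrix is multiplied
  by the same diagonal matrix on the right.\<close>

definition chan_scale :: "('a, 'b) ring_scheme \<Rightarrow> nat \<Rightarrow> nat \<Rightarrow> nat \<Rightarrow> (nat \<Rightarrow> nat \<Rightarrow> nat \<Rightarrow> 'a)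
    \<Rightarrow> (nat \<Rightarrow> nat \<Rightarrow> 'a) \<Rightarrow> nat \<Rightarrow> nat \<Rightarrow> nat \<Rightarrow> 'a" where
  "chan_scale R K B n G D = (\<lambda>k\<in>{..<K}. row_scale R B n (G k) D)"

lemma Gset_eq_row_set: "Gset R K B M n = PiE {..<K} (\<lambda>k. row_set R B n (M k))"
  unfolding Gset_def row_set_def ..

lemma finite_row_set: "finite (carrier R) \<Longrightarrow> finite (row_set R B n m)"
  unfolding row_set_def by (intro finite_PiE) auto

lemma finite_Gset: "finite (carrier R) \<Longrightarrow> finite (Gset R K B M n)"
  unfolding Gset_eq_row_set by (intro finite_PiE finite_row_set) auto

lemma row_set_ext:
  fixes R :: "('a, 'b) ring_scheme"
  assumes "A \<in> row_set R B n m" "A' \<in> row_set R B n m'"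
    and "\<And>\<tau> j. \<tau> < n \<Longrightarrow> j < B \<Longrightarrow> A \<tau> j = A' \<tau> j"
  shows "A = A'"
proof -
  let ?E = "PiE {..<n} (\<lambda>\<tau>. PiE {..<B} (\<lambda>j. UNIV :: 'a set))"
  have sub: "row_set R B n m \<subseteq> ?E" for m
    unfolding row_set_def by (intro PiE_mono subset_UNIV)
  have E: "A \<in> ?E" "A' \<in> ?E" using sub assms(1,2) by blast+
  show ?thesis
  proof (rule PiE_ext[OF E])
    fix \<tau> assume t: "\<tau> \<in> {..<n}"
    show "A \<tau> = A' \<tau>"
      by (rule PiE_ext[OF PiE_mem[OF E(1) t] PiE_mem[OF E(2) t]]) (use assms(3) t in auto)
  qed
qed

section \<open>The action of scalings on coefficient sequences\<close>

context field
begin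

lemma row_setD:
  assumes "A \<in> row_set R B n m" "\<tau> < n" "j < B"
  shows "A \<tau> j \<in> carrier R" "A \<tau> j = \<zero> \<longleftrightarrow> \<not> m j"
proof -
  have "A \<tau> j \<in> (if m j then carrier R - {\<zero>} else {\<zero>})"
    using PiE_mem[OF PiE_mem[OF assms(1)[unfolded row_set_def]]] assms(2,3) by simp
  thus "A \<tau> j \<in> carrier R" "A \<tau> j = \<zero> \<longleftrightarrow> \<not> m j"
    by (auto split: if_splits)
qed

lemma row_setI:
  assumes "\<And>\<tau> j. \<tau> < n \<Longrightarrow> j < B \<Longrightarrow> f \<tau> j \<in> carrier R \<and> (f \<tau> j = \<zero> \<longleftrightarrow> \<not> m j)"
  shows "(\<lambda>\<tau>\<in>{..<n}. \<lambda>j\<in>{..<B}. f \<tau> j) \<in> row_set R B n m"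
  unfolding row_set_def restrict_PiE_iff
proof (intro ballI)
  fix \<tau> j assume "\<tau> \<in> {..<n}" "j \<in> {..<B}"
  thus "f \<tau> j \<in> (if m j then carrier R - {\<zero>} else {\<zero>})"
    using assms[of \<tau> j] by auto
qed

lemma row_set_subset_Xset: "row_set R B n m \<subseteq> Xset R n B"
  unfolding row_set_def Xset_def by (intro PiE_mono) (auto split: if_splits)

lemma row_scale_closed:
  assumes "A \<in> row_set R B n m" "D \<in> row_set R B n (\<lambda>_. True)"
  shows "row_scale R B n A D \<in> row_set R B n m"
  unfolding row_scale_def
proof (rule row_setI)
  fix \<tau> j assume "\<tau> < n" "j < B"
  thus "A \<tau> j \<otimes> D \<tau> j \<in> carrier R \<and> (A \<tau> j \<otimes> D \<tau> j = \<zero> \<longleftrightarrow> \<not> m j)"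
    using row_setD[OF assms(1), of \<tau> j] row_setD[OF assms(2), of \<tau> j] integral_iff by auto
qed

lemma row_scale_assoc:
  assumes "A \<in> row_set R B n m" "D \<in> row_set R B n (\<lambda>_. True)" "E \<in> row_set R B n (\<lambda>_. True)"
  shows "row_scale R B n (row_scale R B n A D) E = row_scale R B n A (row_scale R B n D E)"
proof -
  have DE: "row_scale R B n D E \<in> row_set R B n (\<lambda>_. True)" by (rule row_scale_closed) fact+
  show ?thesis
    by (rule row_set_ext[OF row_scale_closed[OF row_scale_closed[OF assms(1,2)] assms(3)]
          row_scale_closed[OF assms(1) DE]])
      (use row_setD[OF assms(1)] row_setD[OF assms(2)] row_setD[OF assms(3)] in
        \<open>simp add: row_scale_def m_assoc\<close>)
qed

lemma row_scale_bij_right: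
  assumes fin: "finite (carrier R)" and D: "D \<in> row_set R B n (\<lambda>_. True)"
  shows "bij_betw (\<lambda>A. row_scale R B n A D) (row_set R B n m) (row_set R B n m)"
proof -
  have "inj_on (\<lambda>A. row_scale R B n A D) (row_set R B n m)"
  proof (rule inj_onI)
    fix A A' assume A: "A \<in> row_set R B n m" "A' \<in> row_set R B n m"
      and eq: "row_scale R B n A D = row_scale R B n A' D"
    show "A = A'"
    proof (rule row_set_ext[OF A])
      fix \<tau> j assume tj: "\<tau> < n" "j < B"
      have "A \<tau> j \<otimes> D \<tau> j = A' \<tau> j \<otimes> D \<tau> j"
        using fun_cong[OF fun_cong[OF eq, of \<tau>], of j] tj by (simp add: row_scale_def)
      thus "A \<tau> j = A' \<tau> j"
        using row_setD[OF A(1) tj] row_setD[OF A(2) tj] row_setD[OF D tj] m_rcancel by auto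
    qed
  qed
  moreover have "(\<lambda>A. row_scale R B n A D) ` row_set R B n m \<subseteq> row_set R B n m"
    using row_scale_closed D by auto
  ultimately show ?thesis
    using endo_inj_surj[OF finite_row_set[OF fin]] unfolding bij_betw_def by blast
qed

lemma row_scale_comm:
  assumes "A \<in> row_set R B n (\<lambda>_. True)" "D \<in> row_set R B n (\<lambda>_. True)"
  shows "row_scale R B n A D = row_scale R B n D A"
  by (rule row_set_ext[OF row_scale_closed[OF assms] row_scale_closed[OF assms(2,1)]])
    (use row_setD[OF assms(1)] row_setD[OF assms(2)] in \<open>simp add: row_scale_def m_comm\<close>)

lemma row_scale_transitive:
  assumes A: "A \<in> row_set R B n m" and A': "A' \<in> row_set R B n m"
  shows "\<exists>D\<in>row_set R B n (\<lambda>_. True). A' = row_scale R B n A D"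
proof -
  \<comment> \<open>The entrywise quotient of \<open>A'\<close> by \<open>A\<close>. Outside the
    mask both sequences vanish, and \<open>\<one>\<close> is a nonzero factor that keeps
    \<open>D\<close> a scaling.\<close>
  define D where "D = (\<lambda>\<tau>\<in>{..<n}. \<lambda>j\<in>{..<B}. if m j then inv (A \<tau> j) \<otimes> A' \<tau> j else \<one>)"
  have D: "D \<in> row_set R B n (\<lambda>_. True)"
    unfolding D_def
  proof (rule row_setI)
    fix \<tau> j assume tj: "\<tau> < n" "j < B"
    show "(if m j then inv (A \<tau> j) \<otimes> A' \<tau> j else \<one>) \<in> carrier R \<and>
        ((if m j then inv (A \<tau> j) \<otimes> A' \<tau> j else \<one>) = \<zero> \<longleftrightarrow> \<not> True)"
    proof (cases "m j")
      case True
      have a: "A \<tau> j \<in> Units R" "A' \<tau> j \<in> Units R"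
        using True row_setD[OF A tj] row_setD[OF A' tj] field_Units by auto
      hence "inv (A \<tau> j) \<otimes> A' \<tau> j \<in> Units R" by (intro Units_m_closed Units_inv_Units)
      thus ?thesis using True field_Units by auto
    qed auto
  qed
  have "A' = row_scale R B n A D"
  proof (rule row_set_ext[OF A' row_scale_closed[OF A D]])
    fix \<tau> j assume tj: "\<tau> < n" "j < B"
    show "A' \<tau> j = row_scale R B n A D \<tau> j"
    proof (cases "m j")
      case True
      have a: "A \<tau> j \<in> Units R" "A' \<tau> j \<in> carrier R"
        using True row_setD[OF A tj] row_setD[OF A' tj] field_Units by auto
      have "A \<tau> j \<otimes> (inv (A \<tau> j) \<otimes> A' \<tau> j) = A \<tau> j \<otimes> inv (A \<tau> j) \<otimes> A' \<tau> j"
        using a by (intro m_assoc[symmetric]) auto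
      also have "\<dots> = A' \<tau> j" using a by simp
      finally show ?thesis using True tj by (simp add: row_scale_def D_def)
    next
      case False
      thus ?thesis using row_setD[OF A tj] row_setD[OF A' tj] tj by (simp add: row_scale_def D_def)
    qed
  qed
  thus ?thesis using D by blast
qed

lemma chan_scale_closed:
  assumes "G \<in> Gset R K B M n" "D \<in> row_set R B n (\<lambda>_. True)"
  shows "chan_scale R K B n G D \<in> Gset R K B M n"
  using assms row_scale_closed unfolding Gset_eq_row_set chan_scale_def by (auto simp: PiE_iff)

lemma chan_scale_bij:
  assumes fin: "finite (carrier R)" and D: "D \<in> row_set R B n (\<lambda>_. True)"
  shows "bij_betw (\<lambda>G. chan_scale R K B n G D) (Gset R K B M n) (Gset R K B M n)"
proof -
  have "inj_on (\<lambda>G. chan_scale R K B n G D) (Gset R K B M n)"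
  proof (rule inj_onI)
    fix G G' assume G: "G \<in> Gset R K B M n" "G' \<in> Gset R K B M n"
      and eq: "chan_scale R K B n G D = chan_scale R K B n G' D"
    show "G = G'"
    proof (rule PiE_ext[OF G[unfolded Gset_eq_row_set]])
      fix k assume k: "k \<in> {..<K}"
      have "row_scale R B n (G k) D = row_scale R B n (G' k) D"
        using fun_cong[OF eq, of k] k by (simp add: chan_scale_def)
      moreover have "G k \<in> row_set R B n (M k)" "G' k \<in> row_set R B n (M k)"
        using G k unfolding Gset_eq_row_set by (auto simp: PiE_iff)
      ultimately show "G k = G' k"
        using row_scale_bij_right[OF fin D, of "M k"] unfolding bij_betw_def inj_on_def by blast
    qed
  qed
  moreover have "(\<lambda>G. chan_scale R K B n G D) ` Gset R K B M n \<subseteq> Gset R K B M n"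
    using chan_scale_closed D by auto
  ultimately show ?thesis
    using endo_inj_surj[OF finite_Gset[OF fin]] unfolding bij_betw_def by blast
qed

text \<open>Since scalings act transitively on the coefficient sequences of one receiver, a single
  receiver cannot tell the true channel from a randomly rescaled fixed realisation.\<close>

lemma row_average_rescaled:
  fixes f :: "(nat \<Rightarrow> nat \<Rightarrow> 'a) \<Rightarrow> real"
  assumes fin: "finite (carrier R)" and k: "k < K" and A: "A \<in> row_set R B n (M k)"
  shows "real (card (row_set R B n (\<lambda>_. True))) * (\<Sum>G\<in>Gset R K B M n. f (G k))
       = real (card (Gset R K B M n)) * (\<Sum>D\<in>row_set R B n (\<lambda>_. True). f (row_scale R B n A D))"
proof -
  let ?D = "row_set R B n (\<lambda>_. True)" and ?G = "Gset R K B M n"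
  \<comment> \<open>Any other base point is \<open>A\<close> scaled by some \<open>E\<close>, and
    replacing \<open>D\<close> by \<open>D\<close> times \<open>E\<close> permutes the
    scalings.\<close>
  have orbit: "(\<Sum>D\<in>?D. f (row_scale R B n A' D)) = (\<Sum>D\<in>?D. f (row_scale R B n A D))"
    if A': "A' \<in> row_set R B n (M k)" for A'
  proof -
    obtain E where E: "E \<in> ?D" "A' = row_scale R B n A E"
      using row_scale_transitive[OF A A'] by blast
    have "(\<Sum>D\<in>?D. f (row_scale R B n A' D)) = (\<Sum>D\<in>?D. f (row_scale R B n A (row_scale R B n D E)))"
      using row_scale_assoc[OF A E(1)] row_scale_comm[OF _ E(1)] unfolding E(2) by (intro sum.cong) auto
    also have "\<dots> = (\<Sum>D\<in>?D. f (row_scale R B n A D))"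
      by (rule sum.reindex_bij_betw[OF row_scale_bij_right[OF fin E(1)]])
    finally show ?thesis .
  qed
  \<comment> \<open>Double counting: the sum over \<open>G\<close> and \<open>D\<close> is evaluated
    once by \<open>orbit\<close>, for fixed \<open>G\<close>, and once by the invariance of
    \<open>Gset\<close> under scaling, for fixed \<open>D\<close>.\<close>
  have "(\<Sum>G\<in>?G. \<Sum>D\<in>?D. f (row_scale R B n (G k) D)) = (\<Sum>G\<in>?G. \<Sum>D\<in>?D. f (row_scale R B n A D))"
    using k by (intro sum.cong refl orbit) (auto simp: Gset_eq_row_set PiE_iff)
  moreover have "(\<Sum>G\<in>?G. f (row_scale R B n (G k) D)) = (\<Sum>G\<in>?G. f (G k))" if "D \<in> ?D" for D
  proof -
    have "(\<Sum>G\<in>?G. f (row_scale R B n (G k) D)) = (\<Sum>G\<in>?G. f (chan_scale R K B n G D k))"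
      using k by (simp add: chan_scale_def)
    also have "\<dots> = (\<Sum>G\<in>?G. f (G k))"
      by (rule sum.reindex_bij_betw[OF chan_scale_bij[OF fin that], of "\<lambda>G. f (G k)"])
    finally show ?thesis .
  qed
  hence "(\<Sum>G\<in>?G. \<Sum>D\<in>?D. f (row_scale R B n (G k) D)) = (\<Sum>D\<in>?D. \<Sum>G\<in>?G. f (G k))"
    by (subst sum.swap) simp
  ultimately show ?thesis by simp
qed

section \<open>Output tuples of a rescaled fixed matrix\<close>

lemma finite_Xset: "finite (carrier R) \<Longrightarrow> finite (Xset R n B)"
  unfolding Xset_def by (intro finite_PiE) auto

lemma XsetD: "x \<in> Xset R n B \<Longrightarrow> \<tau> < n \<Longrightarrow> j < B \<Longrightarrow> x \<tau> j \<in> carrier R"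
  unfolding Xset_def by (auto simp: PiE_iff)

lemma chan_out_closed:
  assumes "\<And>\<tau> j. \<tau> < n \<Longrightarrow> j < B \<Longrightarrow> G k \<tau> j \<in> carrier R" "x \<in> Xset R n B"
  shows "chan_out R B n G x k \<in> Yset R n"
  using assms XsetD[OF assms(2)] unfolding chan_out_def Yset_def
  by (auto intro!: finsum_closed)

text \<open>The receivers in a maximal independent set of rows of \<open>H\<close> determine the
  outputs of all others, use by use. There are rank many of them, each with at most
  \<open>q^n\<close> output sequences.\<close>

lemma card_outputs_le:
  assumes fin: "finite (carrier R)"
    and H: "\<And>i j. i < K \<Longrightarrow> j < B \<Longrightarrow> H i j \<in> carrier R"
    and D: "D \<in> row_set R B n (\<lambda>_. True)"
    and G: "\<And>k \<tau> j. k < K \<Longrightarrow> \<tau> < n \<Longrightarrow> j < B \<Longrightarrow> G k \<tau> j = H k j \<otimes> D \<tau> j"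
  shows "card ((\<lambda>x. \<lambda>k\<in>{..<K}. chan_out R B n G x k) ` Xset R n B)
    \<le> card (carrier R) ^ (mat_rank R K B H * n)"
proof -
  let ?Y = "\<lambda>x. \<lambda>k\<in>{..<K}. chan_out R B n G x k"
  obtain S where S: "S \<subseteq> {..<K}" "rows_indep R B H S" "card S = mat_rank R K B H"
    and max: "\<And>k. k < K \<Longrightarrow> k \<notin> S \<Longrightarrow> \<not> rows_indep R B H (insert k S)"
    using ex_maximal_indep_rows[of K R B H] by metis
  have finS: "finite S" using S(1) finite_subset by auto
  have SK: "i < K" if "i \<in> S" for i using S(1) that by auto
  have Dc: "D \<tau> j \<in> carrier R" if "\<tau> < n" "j < B" for \<tau> j
    using row_setD(1)[OF D that] .
  have Gc: "G k \<tau> j \<in> carrier R" if "k < K" "\<tau> < n" "j < B" for k \<tau> j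
    unfolding G[OF that] using H[OF that(1,3)] Dc[OF that(2,3)] by (rule m_closed)
  have Dx: "D \<tau> j \<otimes> x \<tau> j \<in> carrier R" if "x \<in> Xset R n B" "\<tau> < n" "j < B" for x \<tau> j
    using Dc[OF that(2,3)] XsetD[OF that] by (rule m_closed)
  \<comment> \<open>The factors move from the coefficients to the input: up to the substitution of
    \<open>D\<close> times \<open>x\<close> for \<open>x\<close>, every use has the same matrix
    \<open>H\<close>.\<close>
  have out: "chan_out R B n G x k \<tau> = (\<Oplus>j\<in>{..<B}. H k j \<otimes> (D \<tau> j \<otimes> x \<tau> j))"
    if k: "k < K" and t: "\<tau> < n" and x: "x \<in> Xset R n B" for k \<tau> x
  proof -
    have "(\<Oplus>j\<in>{..<B}. G k \<tau> j \<otimes> x \<tau> j) = (\<Oplus>j\<in>{..<B}. H k j \<otimes> (D \<tau> j \<otimes> x \<tau> j))"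
    proof (rule finsum_cong')
      fix j assume "j \<in> {..<B}"
      hence j: "j < B" by simp
      show "G k \<tau> j \<otimes> x \<tau> j = H k j \<otimes> (D \<tau> j \<otimes> x \<tau> j)"
        unfolding G[OF k t j] using H[OF k j] Dc[OF t j] XsetD[OF x t j] by (rule m_assoc)
    next
      show "(\<lambda>j. H k j \<otimes> (D \<tau> j \<otimes> x \<tau> j)) \<in> {..<B} \<rightarrow> carrier R"
        using m_closed[OF H[OF k] Dx[OF x t]] by (intro Pi_I) simp
    qed simp
    thus ?thesis unfolding chan_out_def using t by simp
  qed
  have "inj_on (\<lambda>y. restrict y S) (?Y ` Xset R n B)"
  proof (rule inj_onI)
    fix y y' assume "y \<in> ?Y ` Xset R n B" "y' \<in> ?Y ` Xset R n B"
      and eq: "restrict y S = restrict y' S"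
    then obtain x x' where x: "x \<in> Xset R n B" "x' \<in> Xset R n B"
      and y: "y = ?Y x" "y' = ?Y x'" by blast
    have S_eq: "chan_out R B n G x i = chan_out R B n G x' i" if i: "i \<in> S" for i
      using fun_cong[OF eq, of i] i SK[OF i] unfolding y by simp
    have "chan_out R B n G x k = chan_out R B n G x' k" if k: "k < K" for k
    proof (cases "k \<in> S")
      case False
      have Yc: "chan_out R B n G x k \<in> Yset R n" if "x \<in> Xset R n B" for x
        by (rule chan_out_closed) (use Gc k that in auto)
      show ?thesis
      proof (rule PiE_ext[OF Yc[OF x(1), unfolded Yset_def] Yc[OF x(2), unfolded Yset_def]])
        fix \<tau> assume "\<tau> \<in> {..<n}"
        hence t: "\<tau> < n" by simp
        have "(\<Oplus>j\<in>{..<B}. H k j \<otimes> (D \<tau> j \<otimes> x \<tau> j)) = (\<Oplus>j\<in>{..<B}. H k j \<otimes> (D \<tau> j \<otimes> x' \<tau> j))"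
        proof (rule dependent_row_determined[OF finS S(2) False max[OF k False]])
          fix i assume i: "i \<in> S"
          show "(\<Oplus>j\<in>{..<B}. H i j \<otimes> (D \<tau> j \<otimes> x \<tau> j)) = (\<Oplus>j\<in>{..<B}. H i j \<otimes> (D \<tau> j \<otimes> x' \<tau> j))"
            unfolding out[OF SK[OF i] t x(1), symmetric] out[OF SK[OF i] t x(2), symmetric] S_eq[OF i] ..
        next
          fix i j assume "i \<in> insert k S" "j < B"
          thus "H i j \<in> carrier R" using H SK k by blast
        qed (rule Dx[OF x(1) t] Dx[OF x(2) t], assumption)+
        thus "chan_out R B n G x k \<tau> = chan_out R B n G x' k \<tau>"
          unfolding out[OF k t x(1)] out[OF k t x(2)] .
      qed
    qed (rule S_eq)
    thus "y = y'" unfolding y by (auto intro!: restrict_ext)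
  qed
  moreover have "(\<lambda>y. restrict y S) ` ?Y ` Xset R n B \<subseteq> PiE S (\<lambda>_. Yset R n)"
  proof (intro image_subsetI)
    fix y assume "y \<in> ?Y ` Xset R n B"
    then obtain x where x: "x \<in> Xset R n B" "y = ?Y x" by blast
    show "restrict y S \<in> PiE S (\<lambda>_. Yset R n)"
      unfolding restrict_PiE_iff
    proof
      fix i assume i: "i \<in> S"
      have "chan_out R B n G x i \<in> Yset R n"
        by (rule chan_out_closed[OF _ x(1)]) (rule Gc[OF SK[OF i]])
      thus "y i \<in> Yset R n" using SK[OF i] unfolding x(2) by simp
    qed
  qed
  moreover have "finite (PiE S (\<lambda>_. Yset R n))"
    unfolding Yset_def using finS fin by (intro finite_PiE) auto
  ultimately have "card (?Y ` Xset R n B) \<le> card (PiE S (\<lambda>_. Yset R n))"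
    by (rule card_inj_on_le)
  also have "\<dots> = card (carrier R) ^ (mat_rank R K B H * n)"
    using finS S(3) by (simp add: card_PiE Yset_def power_mult[symmetric] mult.commute)
  finally show ?thesis .
qed

end

section \<open>No-signaling marginals\<close>

lemma finite_Wset: "finite (Wset K m)"
  unfolding Wset_def by (intro finite_PiE) auto

lemma WsetD: "v \<in> Wset K m \<Longrightarrow> k < K \<Longrightarrow> v k < m k"
  unfolding Wset_def by (auto dest: PiE_mem)

lemma Wset_eqI:
  assumes "v \<in> Wset K m" "v' \<in> Wset K m" "\<And>k. k < K \<Longrightarrow> v k = v' k"
  shows "v = v'"
  by (rule PiE_ext[OF assms(1,2)[unfolded Wset_def]]) (use assms(3) in auto)

lemma sch_out_0: "sch_out K x v 0 = Inl x"
  and sch_out_Suc: "k < K \<Longrightarrow> sch_out K x v (Suc k) = Inr (v k)"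
  unfolding sch_out_def by auto

lemma sch_out_closed:
  assumes "x \<in> Xset R n B" "v \<in> Wset K m"
  shows "sch_out K x v \<in> PiE {..<Suc K} (sch_O R K B n m)"
  unfolding sch_out_def restrict_PiE_iff
proof
  fix p assume p: "p \<in> {..<Suc K}"
  show "(if p = 0 then Inl x else Inr (v (p - 1))) \<in> sch_O R K B n m p"
    using assms(1) WsetD[OF assms(2), of "p - 1"] p by (cases p) (auto simp: sch_O_def)
qed

text \<open>Translates between sums over output tuples indexed by parties, as in
  \<open>ns_box\<close>, and double sums over channel inputs and decoded messages.\<close>

lemma sch_out_bij:
  "bij_betw (\<lambda>(x, v). sch_out K x v) (Xset R n B \<times> Wset K m) (PiE {..<Suc K} (sch_O R K B n m))"
  unfolding bij_betw_def
proof
  show "inj_on (\<lambda>(x, v). sch_out K x v) (Xset R n B \<times> Wset K m)"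
  proof (rule inj_onI, clarify)
    fix x v x' v' assume v: "v \<in> Wset K m" "v' \<in> Wset K m"
      and eq: "sch_out K x v = sch_out K x' v'"
    have "x = x'" using fun_cong[OF eq, of 0] by (simp add: sch_out_0)
    moreover have "v = v'"
    proof (rule Wset_eqI[OF v])
      fix k assume "k < K"
      thus "v k = v' k" using fun_cong[OF eq, of "Suc k"] by (simp add: sch_out_Suc)
    qed
    ultimately show "x = x' \<and> v = v'" ..
  qed
  show "(\<lambda>(x, v). sch_out K x v) ` (Xset R n B \<times> Wset K m) = PiE {..<Suc K} (sch_O R K B n m)"
  proof (intro equalityI subsetI)
    fix a assume "a \<in> (\<lambda>(x, v). sch_out K x v) ` (Xset R n B \<times> Wset K m)"
    thus "a \<in> PiE {..<Suc K} (sch_O R K B n m)" using sch_out_closed[of _ R n B _ K m] by auto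
  next
    fix a assume a: "a \<in> PiE {..<Suc K} (sch_O R K B n m)"
    have "a 0 \<in> Inl ` Xset R n B" using PiE_mem[OF a, of 0] by (simp add: sch_O_def)
    then obtain x where x: "x \<in> Xset R n B" "a 0 = Inl x" by blast
    have "a (Suc k) \<in> Inr ` {..<m k}" if "k < K" for k
      using PiE_mem[OF a, of "Suc k"] that by (simp add: sch_O_def)
    hence "\<forall>k. \<exists>u. k < K \<longrightarrow> a (Suc k) = Inr u \<and> u < m k" by blast
    then obtain u where u: "\<And>k. k < K \<Longrightarrow> a (Suc k) = Inr (u k)" "\<And>k. k < K \<Longrightarrow> u k < m k"
      by metis
    define v where "v = restrict u {..<K}"
    have v: "v \<in> Wset K m" unfolding v_def Wset_def using u(2) by auto
    have "a = sch_out K x v"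
    proof (rule PiE_ext[OF a sch_out_closed[OF x(1) v]])
      fix p assume "p \<in> {..<Suc K}"
      thus "a p = sch_out K x v p"
        using x(2) u(1)[of "p - 1"] by (cases p) (auto simp: sch_out_0 sch_out_Suc v_def)
    qed
    thus "a \<in> (\<lambda>(x, v). sch_out K x v) ` (Xset R n B \<times> Wset K m)" using x(1) v by force
  qed
qed

lemma bij_betw_filter:
  assumes "bij_betw f A A'"
  shows "bij_betw f {a \<in> A. Q (f a)} {b \<in> A'. Q b}"
  using assms unfolding bij_betw_def inj_on_def by blast

text \<open>The no-signaling condition for the parties in \<open>S\<close>, in the coordinates of
  \<open>sch_out_bij\<close>. The fibre is a variable \<open>C\<close> with an equation, so that
  each instance can supply a simpler description of it.\<close>

lemma ns_scheme_marginal: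
  assumes ns: "ns_scheme R K B n m P" and S: "S \<subseteq> {..<Suc K}"
    and y: "y \<in> PiE {..<Suc K} (sch_I R K B n m)" "y' \<in> PiE {..<Suc K} (sch_I R K B n m)"
    and eq: "\<And>p. p \<in> S \<Longrightarrow> y p = y' p"
    and x: "x \<in> Xset R n B" and v: "v \<in> Wset K m"
    and C: "C = {c \<in> Xset R n B \<times> Wset K m. \<forall>p\<in>S. sch_out K (fst c) (snd c) p = sch_out K x v p}"
  shows "(\<Sum>c\<in>C. P y (sch_out K (fst c) (snd c))) = (\<Sum>c\<in>C. P y' (sch_out K (fst c) (snd c)))"
proof -
  let ?A = "{a' \<in> PiE {..<Suc K} (sch_O R K B n m). \<forall>p\<in>S. a' p = sch_out K x v p}"
  have bij: "bij_betw (\<lambda>(x, v). sch_out K x v) C ?A"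
    using bij_betw_filter[OF sch_out_bij, where Q = "\<lambda>a'. \<forall>p\<in>S. a' p = sch_out K x v p"]
    unfolding C by (simp add: case_prod_beta)
  have "(\<Sum>c\<in>C. P z (sch_out K (fst c) (snd c))) = (\<Sum>a\<in>?A. P z a)" for z
    using sum.reindex_bij_betw[OF bij, of "P z"] by (simp add: case_prod_beta)
  moreover have "(\<Sum>a\<in>?A. P y a) = (\<Sum>a\<in>?A. P y' a)"
  proof -
    have *: "\<forall>S\<subseteq>{..<Suc K}. \<forall>x\<in>PiE {..<Suc K} (sch_I R K B n m). \<forall>x'\<in>PiE {..<Suc K} (sch_I R K B n m).
        (\<forall>p\<in>S. x p = x' p) \<longrightarrow>
        (\<forall>a\<in>PiE {..<Suc K} (sch_O R K B n m).
           (\<Sum>a'\<in>{a'\<in>PiE {..<Suc K} (sch_O R K B n m). \<forall>p\<in>S. a' p = a p}. P x a') =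
           (\<Sum>a'\<in>{a'\<in>PiE {..<Suc K} (sch_O R K B n m). \<forall>p\<in>S. a' p = a p}. P x' a'))"
      using ns unfolding ns_scheme_def ns_box_def by (elim conjE)
    show ?thesis
      by (rule *[rule_format, OF S y eq sch_out_closed[OF x v]])
  qed
  ultimately show ?thesis by simp
qed

lemma ns_tx_marginal:
  assumes ns: "ns_scheme R K B n m P"
    and y: "y \<in> PiE {..<Suc K} (sch_I R K B n m)" "y' \<in> PiE {..<Suc K} (sch_I R K B n m)"
    and eq: "y 0 = y' 0" and x: "x \<in> Xset R n B" and v: "v \<in> Wset K m"
  shows "(\<Sum>v\<in>Wset K m. P y (sch_out K x v)) = (\<Sum>v\<in>Wset K m. P y' (sch_out K x v))"
proof -
  have C: "Pair x ` Wset K m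
    = {c \<in> Xset R n B \<times> Wset K m. \<forall>p\<in>{0}. sch_out K (fst c) (snd c) p = sch_out K x v p}"
    using x by (auto simp: sch_out_0)
  have "inj_on (Pair x) (Wset K m)" by (simp add: inj_on_def)
  thus ?thesis
    using ns_scheme_marginal[OF ns _ y _ x v C] eq by (simp add: sum.reindex)
qed

lemma ns_tx_rx_marginal:
  assumes ns: "ns_scheme R K B n m P"
    and y: "y \<in> PiE {..<Suc K} (sch_I R K B n m)" "y' \<in> PiE {..<Suc K} (sch_I R K B n m)"
    and k: "k < K" and eq: "y 0 = y' 0" "y (Suc k) = y' (Suc k)"
    and x: "x \<in> Xset R n B" and v: "v \<in> Wset K m"
  shows "(\<Sum>v'\<in>{v' \<in> Wset K m. v' k = v k}. P y (sch_out K x v'))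
       = (\<Sum>v'\<in>{v' \<in> Wset K m. v' k = v k}. P y' (sch_out K x v'))"
proof -
  have C: "Pair x ` {v' \<in> Wset K m. v' k = v k}
    = {c \<in> Xset R n B \<times> Wset K m. \<forall>p\<in>{0, Suc k}. sch_out K (fst c) (snd c) p = sch_out K x v p}"
    using x k by (auto simp: sch_out_0 sch_out_Suc)
  have "inj_on (Pair x) {v' \<in> Wset K m. v' k = v k}" by (simp add: inj_on_def)
  thus ?thesis
    using ns_scheme_marginal[OF ns _ y _ x v C] eq k by (auto simp: sum.reindex)
qed

text \<open>No signaling from the transmitter to all receivers jointly: it allows the message tuple
  fed to the box to be exchanged while the guesses are kept.\<close>

lemma ns_rx_marginal:
  assumes ns: "ns_scheme R K B n m P"
    and y: "y \<in> PiE {..<Suc K} (sch_I R K B n m)" "y' \<in> PiE {..<Suc K} (sch_I R K B n m)"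
    and eq: "\<And>k. k < K \<Longrightarrow> y (Suc k) = y' (Suc k)" and v: "v \<in> Wset K m"
  shows "(\<Sum>x\<in>Xset R n B. P y (sch_out K x v)) = (\<Sum>x\<in>Xset R n B. P y' (sch_out K x v))"
proof (cases "Xset R n B = {}")
  case False
  then obtain x where x: "x \<in> Xset R n B" by blast
  have C: "(\<lambda>x. (x, v)) ` Xset R n B
    = {c \<in> Xset R n B \<times> Wset K m. \<forall>p\<in>Suc ` {..<K}. sch_out K (fst c) (snd c) p = sch_out K x v p}"
    using v Wset_eqI[of _ K m v] by (auto simp: sch_out_Suc)
  have "inj_on (\<lambda>x. (x, v)) (Xset R n B)" by (simp add: inj_on_def)
  thus ?thesis
    using ns_scheme_marginal[OF ns _ y _ x v C] eq by (auto simp: sum.reindex)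
qed simp

lemma ns_scheme_total:
  assumes "ns_scheme R K B n m P" "y \<in> PiE {..<Suc K} (sch_I R K B n m)"
  shows "(\<Sum>x\<in>Xset R n B. \<Sum>v\<in>Wset K m. P y (sch_out K x v)) = 1"
proof -
  have "(\<Sum>x\<in>Xset R n B. \<Sum>v\<in>Wset K m. P y (sch_out K x v))
      = (\<Sum>c\<in>Xset R n B \<times> Wset K m. P y ((\<lambda>(x, v). sch_out K x v) c))"
    by (simp add: sum.cartesian_product case_prod_beta)
  also have "\<dots> = (\<Sum>a\<in>PiE {..<Suc K} (sch_O R K B n m). P y a)"
    by (rule sum.reindex_bij_betw[OF sch_out_bij])
  also have "\<dots> = 1" using assms unfolding ns_scheme_def ns_box_def by blast
  finally show ?thesis .
qed

lemma ns_scheme_nonneg: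
  assumes "ns_scheme R K B n m P" "y \<in> PiE {..<Suc K} (sch_I R K B n m)"
    "x \<in> Xset R n B" "v \<in> Wset K m"
  shows "0 \<le> P y (sch_out K x v)"
  using assms(1,2) sch_out_closed[OF assms(3,4)] unfolding ns_scheme_def ns_box_def by blast

text \<open>A joint mass of transmitting \<open>x\<close> and guessing wrongly at \<open>k\<close>,
  not a conditional probability. The box input \<open>y\<close> is a free argument, so that the
  inputs of the other receivers can be varied.\<close>

definition rx_err :: "nat \<Rightarrow> (nat \<Rightarrow> nat) \<Rightarrow> 'a scheme_box \<Rightarrow> (nat \<Rightarrow> 'a box_in) \<Rightarrow> (nat \<Rightarrow> nat \<Rightarrow> 'a)
    \<Rightarrow> (nat \<Rightarrow> nat) \<Rightarrow> nat \<Rightarrow> real" where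
  "rx_err K m P y x w k = (\<Sum>v\<in>Wset K m. if v k \<noteq> w k then P y (sch_out K x v) else 0)"

text \<open>Wrong guesses are the complement of one output value, so the error mass is the
  transmitter marginal minus a joint marginal of transmitter and receiver \<open>k\<close>; both
  ignore the inputs of the other receivers.\<close>

lemma rx_err_cong:
  assumes "ns_scheme R K B n m P"
    and "y \<in> PiE {..<Suc K} (sch_I R K B n m)" "y' \<in> PiE {..<Suc K} (sch_I R K B n m)"
    and "k < K" "y 0 = y' 0" "y (Suc k) = y' (Suc k)" "x \<in> Xset R n B" "w \<in> Wset K m"
  shows "rx_err K m P y x w k = rx_err K m P y' x w k"
proof -
  have "rx_err K m P z x w k = (\<Sum>v\<in>Wset K m. P z (sch_out K x v))
      - (\<Sum>v\<in>{v \<in> Wset K m. v k = w k}. P z (sch_out K x v))" for z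
    unfolding rx_err_def sum.inter_filter[OF finite_Wset] sum_subtractf[symmetric]
    by (intro sum.cong) auto
  thus ?thesis
    using ns_tx_marginal[OF assms(1-3,5,7,8)] ns_tx_rx_marginal[OF assms] by simp
qed

text \<open>The union bound, taken for one \<open>x\<close> at a time because the box input
  belonging to the channel changes with \<open>x\<close>.\<close>

lemma sum_rx_err_ge:
  assumes ns: "ns_scheme R K B n m P" and y: "y \<in> PiE {..<Suc K} (sch_I R K B n m)"
    and x: "x \<in> Xset R n B" and w: "w \<in> Wset K m"
  shows "(\<Sum>v\<in>Wset K m. P y (sch_out K x v)) - P y (sch_out K x w) \<le> (\<Sum>k<K. rx_err K m P y x w k)"
proof -
  let ?p = "\<lambda>v. P y (sch_out K x v)"
  have "(\<Sum>v\<in>Wset K m. ?p v) - ?p w = (\<Sum>v\<in>Wset K m - {w}. ?p v)"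
    using finite_Wset w by (simp add: sum_diff1)
  also have "\<dots> \<le> (\<Sum>v\<in>Wset K m - {w}. \<Sum>k<K. if v k \<noteq> w k then ?p v else 0)"
  proof (rule sum_mono)
    fix v assume v: "v \<in> Wset K m - {w}"
    then obtain k where k: "k < K" "v k \<noteq> w k" using Wset_eqI[of v K m w] w by blast
    have "?p v = (if v k \<noteq> w k then ?p v else 0)" using k by simp
    also have "\<dots> \<le> (\<Sum>k<K. if v k \<noteq> w k then ?p v else 0)"
      using k ns_scheme_nonneg[OF ns y x] v by (intro member_le_sum) auto
    finally show "?p v \<le> (\<Sum>k<K. if v k \<noteq> w k then ?p v else 0)" .
  qed
  also have "\<dots> \<le> (\<Sum>v\<in>Wset K m. \<Sum>k<K. if v k \<noteq> w k then ?p v else 0)"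
    using finite_Wset ns_scheme_nonneg[OF ns y x] by (intro sum_mono2 sum_nonneg) auto
  also have "\<dots> = (\<Sum>k<K. rx_err K m P y x w k)"
    unfolding rx_err_def by (rule sum.swap)
  finally show ?thesis .
qed

text \<open>The box input for an output tuple \<open>y\<close> prescribed independently of the
  channel input, in contrast to \<open>sch_in\<close>.\<close>

definition rx_input :: "nat \<Rightarrow> (nat \<Rightarrow> nat) \<Rightarrow> (nat \<Rightarrow> nat \<Rightarrow> nat \<Rightarrow> 'a) \<Rightarrow> (nat \<Rightarrow> nat \<Rightarrow> 'a)
    \<Rightarrow> nat \<Rightarrow> 'a box_in" where
  "rx_input K w G y = restrict (\<lambda>p. if p = 0 then Inl w else Inr (y (p - 1), G (p - 1))) {..<Suc K}"

lemma sch_in_eq_rx_input: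
  "sch_in R K B n w G x = rx_input K w G (\<lambda>k\<in>{..<K}. chan_out R B n G x k)"
  unfolding sch_in_def rx_input_def by (rule restrict_ext) auto

lemma rx_input_closed:
  assumes "w \<in> Wset K m" "\<And>k. k < K \<Longrightarrow> y k \<in> Yset R n" "\<And>k. k < K \<Longrightarrow> G k \<in> Xset R n B"
  shows "rx_input K w G y \<in> PiE {..<Suc K} (sch_I R K B n m)"
  unfolding rx_input_def restrict_PiE_iff
proof
  fix p assume p: "p \<in> {..<Suc K}"
  show "(if p = 0 then Inl w else Inr (y (p - 1), G (p - 1))) \<in> sch_I R K B n m p"
    using assms(1) assms(2,3)[of "p - 1"] p by (cases p) (auto simp: sch_I_def)
qed

text \<open>The decoders see only the output tuple, and for each such tuple their (transmitter-independent)
  guess is right for messages of total mass 1. So with a fixed channel the number of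
  correctly decoded message tuples is at most the number of output tuples.\<close>

lemma success_le_card_outputs:
  assumes ns: "ns_scheme R K B n m P" and fin: "finite (Xset R n B)"
    and G: "\<And>k. k < K \<Longrightarrow> G k \<in> Xset R n B"
    and out: "\<And>x k. x \<in> Xset R n B \<Longrightarrow> k < K \<Longrightarrow> chan_out R B n G x k \<in> Yset R n"
  shows "(\<Sum>w\<in>Wset K m. \<Sum>x\<in>Xset R n B. P (sch_in R K B n w G x) (sch_out K x w))
    \<le> real (card ((\<lambda>x. \<lambda>k\<in>{..<K}. chan_out R B n G x k) ` Xset R n B))"
proof -
  let ?f = "\<lambda>x. \<lambda>k\<in>{..<K}. chan_out R B n G x k"
  let ?Y = "?f ` Xset R n B"
  have Y: "rx_input K w G y \<in> PiE {..<Suc K} (sch_I R K B n m)" if "w \<in> Wset K m" "y \<in> ?Y" for w y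
  proof (rule rx_input_closed[OF that(1) _ G])
    fix k assume "k < K"
    thus "y k \<in> Yset R n" using that(2) out by auto
  qed
  have "Wset K m \<noteq> {}" using ns unfolding ns_scheme_def Wset_def by (auto simp: PiE_eq_empty_iff)
  then obtain w0 where w0: "w0 \<in> Wset K m" by blast
  \<comment> \<open>The true output tuple is one of the terms in the sum over \<open>?Y\<close>.
    Adding the other nonnegative terms frees the decoder inputs from \<open>x\<close>.\<close>
  have "(\<Sum>w\<in>Wset K m. \<Sum>x\<in>Xset R n B. P (sch_in R K B n w G x) (sch_out K x w))
     \<le> (\<Sum>w\<in>Wset K m. \<Sum>x\<in>Xset R n B. \<Sum>y\<in>?Y. P (rx_input K w G y) (sch_out K x w))"
  proof (intro sum_mono)
    fix w x assume w: "w \<in> Wset K m" and x: "x \<in> Xset R n B"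
    show "P (sch_in R K B n w G x) (sch_out K x w) \<le> (\<Sum>y\<in>?Y. P (rx_input K w G y) (sch_out K x w))"
      unfolding sch_in_eq_rx_input
      using fin x ns_scheme_nonneg[OF ns Y[OF w] x w]
      by (intro member_le_sum[of "?f x" ?Y "\<lambda>y. P (rx_input K w G y) (sch_out K x w)"]) auto
  qed
  also have "\<dots> = (\<Sum>w\<in>Wset K m. \<Sum>y\<in>?Y. \<Sum>x\<in>Xset R n B. P (rx_input K w G y) (sch_out K x w))"
    by (rule sum.cong[OF refl]) (rule sum.swap)
  \<comment> \<open>With \<open>y\<close> fixed, the sum over \<open>x\<close> is a marginal of the
    receivers. The transmitter's message becomes \<open>w0\<close>, while \<open>w\<close> remains
    the guess that is counted; summing over \<open>w\<close> then gives total mass 1 for each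
    \<open>y\<close>.\<close>
  also have "\<dots> = (\<Sum>w\<in>Wset K m. \<Sum>y\<in>?Y. \<Sum>x\<in>Xset R n B. P (rx_input K w0 G y) (sch_out K x w))"
  proof (rule sum.cong[OF refl], rule sum.cong[OF refl])
    fix w y assume w: "w \<in> Wset K m" and y: "y \<in> ?Y"
    show "(\<Sum>x\<in>Xset R n B. P (rx_input K w G y) (sch_out K x w))
        = (\<Sum>x\<in>Xset R n B. P (rx_input K w0 G y) (sch_out K x w))"
      by (rule ns_rx_marginal[OF ns Y[OF w y] Y[OF w0 y] _ w]) (simp add: rx_input_def)
  qed
  also have "\<dots> = (\<Sum>y\<in>?Y. \<Sum>w\<in>Wset K m. \<Sum>x\<in>Xset R n B. P (rx_input K w0 G y) (sch_out K x w))"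
    by (rule sum.swap)
  also have "\<dots> = (\<Sum>y\<in>?Y. \<Sum>x\<in>Xset R n B. \<Sum>w\<in>Wset K m. P (rx_input K w0 G y) (sch_out K x w))"
    by (rule sum.cong[OF refl]) (rule sum.swap)
  also have "\<dots> = (\<Sum>y\<in>?Y. 1)"
    by (intro sum.cong refl ns_scheme_total[OF ns Y[OF w0]])
  finally show ?thesis by simp
qed

text \<open>Total mass minus correctly decoded mass, bounded by the union bound. Sums over message
  tuples are kept unnormalised, so the total mass is the number of tuples.\<close>

lemma sum_rx_err_fixed_channel:
  assumes ns: "ns_scheme R K B n m P" and fin: "finite (Xset R n B)" and ne: "Xset R n B \<noteq> {}"
    and G: "\<And>k. k < K \<Longrightarrow> G k \<in> Xset R n B"
    and out: "\<And>x k. x \<in> Xset R n B \<Longrightarrow> k < K \<Longrightarrow> chan_out R B n G x k \<in> Yset R n"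
  shows "real (card (Wset K m)) - real (card ((\<lambda>x. \<lambda>k\<in>{..<K}. chan_out R B n G x k) ` Xset R n B))
    \<le> (\<Sum>k<K. \<Sum>w\<in>Wset K m. \<Sum>x\<in>Xset R n B. rx_err K m P (sch_in R K B n w G x) x w k)"
proof -
  have In: "sch_in R K B n w G x \<in> PiE {..<Suc K} (sch_I R K B n m)"
    if "w \<in> Wset K m" "x \<in> Xset R n B" for w x
    unfolding sch_in_eq_rx_input by (rule rx_input_closed[OF that(1) _ G]) (use out that in auto)
  \<comment> \<open>Normalisation of the box concerns one fixed input, but here the receivers'
    inputs follow \<open>x\<close>. The transmitter marginal ignores them, so all may be replaced by
    those of a single \<open>x0\<close>.\<close>
  have one: "(\<Sum>x\<in>Xset R n B. \<Sum>v\<in>Wset K m. P (sch_in R K B n w G x) (sch_out K x v)) = 1"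
    if w: "w \<in> Wset K m" for w
  proof -
    from ne obtain x0 where x0: "x0 \<in> Xset R n B" by blast
    have "(\<Sum>x\<in>Xset R n B. \<Sum>v\<in>Wset K m. P (sch_in R K B n w G x) (sch_out K x v))
        = (\<Sum>x\<in>Xset R n B. \<Sum>v\<in>Wset K m. P (sch_in R K B n w G x0) (sch_out K x v))"
    proof (rule sum.cong[OF refl])
      fix x assume x: "x \<in> Xset R n B"
      show "(\<Sum>v\<in>Wset K m. P (sch_in R K B n w G x) (sch_out K x v))
          = (\<Sum>v\<in>Wset K m. P (sch_in R K B n w G x0) (sch_out K x v))"
        by (rule ns_tx_marginal[OF ns In[OF w x] In[OF w x0] _ x w]) (simp add: sch_in_def)
    qed
    also have "\<dots> = 1" by (rule ns_scheme_total[OF ns In[OF w x0]])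
    finally show ?thesis .
  qed
  have "real (card (Wset K m)) - real (card ((\<lambda>x. \<lambda>k\<in>{..<K}. chan_out R B n G x k) ` Xset R n B))
    \<le> (\<Sum>w\<in>Wset K m. \<Sum>x\<in>Xset R n B. \<Sum>v\<in>Wset K m. P (sch_in R K B n w G x) (sch_out K x v))
      - (\<Sum>w\<in>Wset K m. \<Sum>x\<in>Xset R n B. P (sch_in R K B n w G x) (sch_out K x w))"
    using success_le_card_outputs[OF ns fin G out] one by simp
  also have "\<dots> = (\<Sum>w\<in>Wset K m. \<Sum>x\<in>Xset R n B.
      (\<Sum>v\<in>Wset K m. P (sch_in R K B n w G x) (sch_out K x v)) - P (sch_in R K B n w G x) (sch_out K x w))"
    by (simp add: sum_subtractf)
  also have "\<dots> \<le> (\<Sum>w\<in>Wset K m. \<Sum>x\<in>Xset R n B. \<Sum>k<K. rx_err K m P (sch_in R K B n w G x) x w k)"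
    by (intro sum_mono sum_rx_err_ge[OF ns] In)
  also have "\<dots> = (\<Sum>w\<in>Wset K m. \<Sum>k<K. \<Sum>x\<in>Xset R n B. rx_err K m P (sch_in R K B n w G x) x w k)"
    by (rule sum.cong[OF refl]) (rule sum.swap)
  also have "\<dots> = (\<Sum>k<K. \<Sum>w\<in>Wset K m. \<Sum>x\<in>Xset R n B. rx_err K m P (sch_in R K B n w G x) x w k)"
    by (rule sum.swap)
  finally show ?thesis .
qed

lemma sch_err_eq:
  "sch_err R K B M n m P k * (real (card (Wset K m)) * real (card (Gset R K B M n)))
    = (\<Sum>G\<in>Gset R K B M n. \<Sum>w\<in>Wset K m. \<Sum>x\<in>Xset R n B. rx_err K m P (sch_in R K B n w G x) x w k)"
  if "card (Wset K m) \<noteq> 0" "card (Gset R K B M n) \<noteq> 0"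
proof -
  have "sch_err R K B M n m P k * (real (card (Wset K m)) * real (card (Gset R K B M n)))
    = (\<Sum>w\<in>Wset K m. \<Sum>G\<in>Gset R K B M n. \<Sum>x\<in>Xset R n B. rx_err K m P (sch_in R K B n w G x) x w k)"
    using that unfolding sch_err_def rx_err_def by simp
  also have "\<dots> = (\<Sum>G\<in>Gset R K B M n. \<Sum>w\<in>Wset K m. \<Sum>x\<in>Xset R n B. rx_err K m P (sch_in R K B n w G x) x w k)"
    by (rule sum.swap)
  finally show ?thesis .
qed

section \<open>Rates and degrees of freedom\<close>

lemma card_Wset: "card (Wset K m) = (\<Prod>k<K. m k)"
  unfolding Wset_def by (simp add: card_PiE)

context field
begin

text \<open>The converse at finite block length: success of all receivers together is limited by the
  ratio of output tuples to message tuples, and everything after this is limits.\<close>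

lemma sum_sch_err_ge:
  assumes fin: "finite (carrier R)" and ns: "ns_scheme R K B n m P"
  shows "1 - real (card (carrier R)) ^ (minrk R K B M * n) / real (card (Wset K m))
    \<le> (\<Sum>k<K. sch_err R K B M n m P k)"
proof -
  obtain H where H: "\<And>i j. i < K \<Longrightarrow> j < B \<Longrightarrow> H i j \<in> carrier R"
    and H0: "\<And>i j. i < K \<Longrightarrow> j < B \<Longrightarrow> H i j = \<zero> \<longleftrightarrow> \<not> M i j"
    and rk: "mat_rank R K B H = minrk R K B M"
    using ex_minrk_matrix[of K B M] by metis
  let ?W = "Wset K m" and ?X = "Xset R n B" and ?D = "row_set R B n (\<lambda>_. True)"
    and ?G = "Gset R K B M n"
  let ?In = "PiE {..<Suc K} (sch_I R K B n m)"
  let ?Q = "card (carrier R) ^ (minrk R K B M * n)"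
  \<comment> \<open>A minimal rank matrix repeated at every use. It is a possible channel
    realisation since \<open>H\<close> vanishes exactly where \<open>M\<close> does.\<close>
  define G0 where "G0 = (\<lambda>k\<in>{..<K}. \<lambda>\<tau>\<in>{..<n}. \<lambda>j\<in>{..<B}. H k j)"
  have G0k: "G0 k \<in> row_set R B n (M k)" if k: "k < K" for k
    unfolding G0_def using k H[OF k] H0[OF k] by (simp add: row_setI)
  have G0: "G0 \<in> ?G"
    unfolding G0_def Gset_eq_row_set restrict_PiE_iff using G0k by (simp add: G0_def)
  have "(\<lambda>\<tau>\<in>{..<n}. \<lambda>j\<in>{..<B}. \<one>) \<in> ?D" by (rule row_setI) simp
  hence Dpos: "0 < card ?D" using finite_row_set[OF fin] by (auto simp: card_gt_0_iff)
  have Gpos: "0 < card ?G" using G0 finite_Gset[OF fin] by (auto simp: card_gt_0_iff)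
  have Wpos: "0 < card ?W"
    using ns unfolding ns_scheme_def card_Wset by (auto intro: prod_pos)
  have finX: "finite ?X" by (rule finite_Xset[OF fin])
  have neX: "?X \<noteq> {}" unfolding Xset_def by (auto simp: PiE_eq_empty_iff)
  have Grow: "G k \<in> row_set R B n (M k)" if "G \<in> ?G" "k < K" for G k
    using PiE_mem[OF that(1)[unfolded Gset_eq_row_set]] that(2) by simp
  have GX: "G k \<in> ?X" if "G \<in> ?G" "k < K" for G k
    using row_set_subset_Xset Grow[OF that] by blast
  have GY: "chan_out R B n G x k \<in> Yset R n" if "G \<in> ?G" "x \<in> ?X" "k < K" for G x k
    by (rule chan_out_closed[OF _ that(2)]) (rule row_setD(1)[OF Grow[OF that(1,3)]])
  have In: "sch_in R K B n w G x \<in> ?In" if "w \<in> ?W" "G \<in> ?G" "x \<in> ?X" for w G x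
    unfolding sch_in_eq_rx_input
    by (rule rx_input_closed[OF that(1) _ GX[OF that(2)]]) (use GY[OF that(2,3)] in auto)
  define T where "T = (\<lambda>k G. \<Sum>w\<in>?W. \<Sum>x\<in>?X. rx_err K m P (sch_in R K B n w G x) x w k)"
  \<comment> \<open>The error of receiver \<open>k\<close> as a function of its own row; the other
    rows are filled in from \<open>G0\<close>, which \<open>T_f\<close> justifies by
    no-signaling.\<close>
  define f where "f = (\<lambda>k g. T k (G0(k := g)))"
  have T_f: "T k G = f k (G k)" if G: "G \<in> ?G" and k: "k < K" for k G
  proof -
    have upd: "G0(k := G k) \<in> ?G"
      using G0 Grow[OF G k] k unfolding Gset_eq_row_set by (auto simp: PiE_iff extensional_def)
    have "rx_err K m P (sch_in R K B n w G x) x w k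
        = rx_err K m P (sch_in R K B n w (G0(k := G k)) x) x w k"
      if w: "w \<in> ?W" and x: "x \<in> ?X" for w x
      by (rule rx_err_cong[OF ns In[OF w G x] In[OF w upd x] k _ _ x w])
        (use k in \<open>simp_all add: sch_in_def chan_out_def\<close>)
    thus ?thesis unfolding T_def f_def by (intro sum.cong refl) simp
  qed
  \<comment> \<open>An exact identity: receiver \<open>k\<close> errs equally often on the true
    channel and on the randomly rescaled \<open>G0\<close>.\<close>
  have err: "real (card ?D) * (sch_err R K B M n m P k * real (card ?W))
      = (\<Sum>D\<in>?D. T k (chan_scale R K B n G0 D))" if k: "k < K" for k
  proof -
    have "real (card ?G) * (real (card ?D) * (sch_err R K B M n m P k * real (card ?W)))
        = real (card ?D) * (\<Sum>G\<in>?G. T k G)"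
      using sch_err_eq[of K m R B M n P k] Wpos Gpos unfolding T_def by (simp add: mult_ac)
    also have "(\<Sum>G\<in>?G. T k G) = (\<Sum>G\<in>?G. f k (G k))"
      by (rule sum.cong[OF refl]) (rule T_f[OF _ k])
    also have "real (card ?D) * \<dots> = real (card ?G) * (\<Sum>D\<in>?D. f k (row_scale R B n (G0 k) D))"
      by (rule row_average_rescaled[where M = M, OF fin k G0k[OF k]])
    also have "(\<Sum>D\<in>?D. f k (row_scale R B n (G0 k) D)) = (\<Sum>D\<in>?D. T k (chan_scale R K B n G0 D))"
    proof (rule sum.cong[OF refl])
      fix D assume D: "D \<in> ?D"
      show "f k (row_scale R B n (G0 k) D) = T k (chan_scale R K B n G0 D)"
        using T_f[OF chan_scale_closed[OF G0 D] k] k by (simp add: chan_scale_def)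
    qed
    finally show ?thesis using Gpos by simp
  qed
  \<comment> \<open>Counting and union bound hold for every single scaling, before averaging over
    \<open>D\<close>.\<close>
  have fixed: "real (card ?W) - real ?Q \<le> (\<Sum>k<K. T k (chan_scale R K B n G0 D))" if D: "D \<in> ?D" for D
  proof -
    let ?S = "chan_scale R K B n G0 D"
    have S: "?S \<in> ?G" by (rule chan_scale_closed[OF G0 D])
    have "card ((\<lambda>x. \<lambda>k\<in>{..<K}. chan_out R B n ?S x k) ` ?X) \<le> ?Q"
      unfolding rk[symmetric]
      by (rule card_outputs_le[OF fin H D]) (simp_all add: chan_scale_def row_scale_def G0_def)
    moreover have "real (card ?W) - real (card ((\<lambda>x. \<lambda>k\<in>{..<K}. chan_out R B n ?S x k) ` ?X))
        \<le> (\<Sum>k<K. T k ?S)"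
      unfolding T_def by (rule sum_rx_err_fixed_channel[OF ns finX neX GX[OF S] GY[OF S]])
    ultimately show ?thesis by linarith
  qed
  have "real (card ?D) * (real (card ?W) - real ?Q) = (\<Sum>D\<in>?D. real (card ?W) - real ?Q)"
    by simp
  also have "\<dots> \<le> (\<Sum>D\<in>?D. \<Sum>k<K. T k (chan_scale R K B n G0 D))"
    by (rule sum_mono) (rule fixed)
  also have "\<dots> = (\<Sum>k<K. \<Sum>D\<in>?D. T k (chan_scale R K B n G0 D))" by (rule sum.swap)
  also have "\<dots> = (\<Sum>k<K. real (card ?D) * (sch_err R K B M n m P k * real (card ?W)))"
    by (rule sum.cong[OF refl]) (simp add: err)
  also have "\<dots> = real (card ?D) * ((\<Sum>k<K. sch_err R K B M n m P k) * real (card ?W))"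
    by (simp add: sum_distrib_left sum_distrib_right)
  finally have "real (card ?W) - real ?Q \<le> (\<Sum>k<K. sch_err R K B M n m P k) * real (card ?W)"
    using Dpos by simp
  thus ?thesis using Wpos by (simp add: field_simps)
qed

lemma rate_achievable_sum_le:
  assumes fin: "finite (carrier R)" and ach: "rate_achievable R K B M r"
  shows "(\<Sum>k<K. r k) \<le> real (minrk R K B M) * log 2 (real (card (carrier R)))"
proof (rule field_le_epsilon)
  fix e :: real assume e: "0 < e"
  \<comment> \<open>\<open>K\<close> shares of \<open>e\<close> are spent on the rates and one on
    the error probability; the denominator also covers \<open>K = 0\<close>.\<close>
  define \<epsilon> where "\<epsilon> = e / (real K + 1)"
  have \<epsilon>: "0 < \<epsilon>" "real K * \<epsilon> + \<epsilon> = e"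
  proof -
    have K: "0 < real K + 1" by simp
    show "0 < \<epsilon>" using e K unfolding \<epsilon>_def by (rule divide_pos_pos)
    have "real K * \<epsilon> + \<epsilon> = (real K + 1) * \<epsilon>" by (simp add: distrib_right)
    also have "\<dots> = e" using K unfolding \<epsilon>_def by simp
    finally show "real K * \<epsilon> + \<epsilon> = e" .
  qed
  obtain ns ms Ps where ns: "\<And>i. ns_scheme R K B (ns i) (ms i) (Ps i)"
    and err: "\<And>k. k < K \<Longrightarrow> (\<lambda>i. sch_err R K B M (ns i) (ms i) (Ps i) k) \<longlonglongrightarrow> 0"
    and rate: "\<And>k. k < K \<Longrightarrow> ereal (r k) \<le> liminf (\<lambda>i. ereal (log 2 (real (ms i k)) / real (ns i)))"
    using ach unfolding rate_achievable_def by blast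
  have "(\<lambda>i. \<Sum>k<K. sch_err R K B M (ns i) (ms i) (Ps i) k) \<longlonglongrightarrow> 0"
    by (rule tendsto_null_sum) (use err in auto)
  \<comment> \<open>Once the errors sum to less than \<open>1 - 2 powr (- \<epsilon>)\<close>, the
    ratio of output tuples to message tuples exceeds \<open>2 powr (- \<epsilon>)\<close>, which
    costs exactly \<open>\<epsilon>\<close> bits after taking logarithms.\<close>
  moreover have "2 powr (- \<epsilon>) < (1::real)"
    using powr_less_mono[of "- \<epsilon>" 0 "2::real"] \<epsilon> by simp
  ultimately have ev1: "\<forall>\<^sub>F i in sequentially.
      (\<Sum>k<K. sch_err R K B M (ns i) (ms i) (Ps i) k) < 1 - 2 powr (- \<epsilon>)"
    by (intro order_tendstoD(2)) auto
  have ev2: "\<forall>\<^sub>F i in sequentially. \<forall>k\<in>{..<K}. r k - \<epsilon> < log 2 (real (ms i k)) / real (ns i)"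
  proof (rule eventually_ball_finite)
    show "\<forall>k\<in>{..<K}. \<forall>\<^sub>F i in sequentially. r k - \<epsilon> < log 2 (real (ms i k)) / real (ns i)"
    proof
      fix k assume "k \<in> {..<K}"
      moreover have "ereal (r k - \<epsilon>) < ereal (r k)" using \<epsilon> by simp
      ultimately show "\<forall>\<^sub>F i in sequentially. r k - \<epsilon> < log 2 (real (ms i k)) / real (ns i)"
        using rate[of k] unfolding le_Liminf_iff by fastforce
    qed
  qed simp
  obtain i where i1: "(\<Sum>k<K. sch_err R K B M (ns i) (ms i) (Ps i) k) < 1 - 2 powr (- \<epsilon>)"
    and i2: "\<And>k. k < K \<Longrightarrow> r k - \<epsilon> < log 2 (real (ms i k)) / real (ns i)"
    using eventually_happens'[OF _ eventually_conj[OF ev1 ev2]] by auto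
  let ?q = "real (card (carrier R))" and ?r = "minrk R K B M"
  have n: "1 \<le> real (ns i)" and mpos: "\<And>k. k < K \<Longrightarrow> 0 < ms i k"
    using ns[of i] unfolding ns_scheme_def by auto
  have W: "0 < real (card (Wset K (ms i)))"
    unfolding card_Wset of_nat_prod by (rule prod_pos) (use mpos in simp)
  have q: "0 < ?q" using fin by (auto simp: card_gt_0_iff)
  have "2 powr (- \<epsilon>) < ?q ^ (?r * ns i) / real (card (Wset K (ms i)))"
    using sum_sch_err_ge[OF fin ns[of i], of M] i1 by linarith
  hence "2 powr (- \<epsilon>) * real (card (Wset K (ms i))) < ?q ^ (?r * ns i)"
    using W by (simp add: field_simps)
  hence "log 2 (2 powr (- \<epsilon>) * real (card (Wset K (ms i)))) < log 2 (?q ^ (?r * ns i))"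
    using W q by (subst log_less_cancel_iff) auto
  moreover have "log 2 (2 powr (- \<epsilon>) * real (card (Wset K (ms i)))) = - \<epsilon> + log 2 (real (card (Wset K (ms i))))"
    using W by (subst log_mult) auto
  moreover have "log 2 (real (card (Wset K (ms i)))) = (\<Sum>k<K. log 2 (real (ms i k)))"
    unfolding card_Wset of_nat_prod log_def using mpos
    by (subst ln_prod) (auto simp: sum_divide_distrib)
  moreover have "log 2 (?q ^ (?r * ns i)) = real ?r * log 2 ?q * real (ns i)"
    using q by (simp add: log_nat_power mult_ac)
  ultimately have "(\<Sum>k<K. log 2 (real (ms i k))) < real ?r * log 2 ?q * real (ns i) + \<epsilon>"
    by linarith
  \<comment> \<open>Uses that the block length is at least 1.\<close>
  also have "\<dots> \<le> (real ?r * log 2 ?q + \<epsilon>) * real (ns i)"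
    using n \<epsilon> by (simp add: distrib_right)
  finally have "(\<Sum>k<K. log 2 (real (ms i k))) / real (ns i) \<le> real ?r * log 2 ?q + \<epsilon>"
    using n by (simp add: field_simps)
  moreover have "(\<Sum>k<K. r k - \<epsilon>) \<le> (\<Sum>k<K. log 2 (real (ms i k)) / real (ns i))"
    by (intro sum_mono less_imp_le i2) simp
  ultimately show "(\<Sum>k<K. r k) \<le> real ?r * log 2 ?q + e"
    using \<epsilon>(2) by (simp add: sum_subtractf sum_divide_distrib[symmetric])
qed

text \<open>Makes the suprema range over nonempty sets, as a real \<open>Sup\<close> of the empty
  set is unspecified. With a single message per receiver no error can occur, whatever the
  deterministic box outputs.\<close>

lemma zero_rate_achievable:
  assumes fin: "finite (carrier R)"
  shows "rate_achievable R K B M (\<lambda>_. 0)"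
proof -
  define m :: "nat \<Rightarrow> nat" where "m = (\<lambda>_. 1)"
  define x0 where "x0 = (\<lambda>\<tau>\<in>{..<1::nat}. \<lambda>j\<in>{..<B}. \<zero>)"
  define v0 where "v0 = (\<lambda>k\<in>{..<K}. 0::nat)"
  have x0: "x0 \<in> Xset R 1 B" unfolding x0_def Xset_def by auto
  have v0: "v0 \<in> Wset K m" unfolding v0_def Wset_def m_def by auto
  define P :: "'a scheme_box" where "P = (\<lambda>y a. if a = sch_out K x0 v0 then 1 else 0)"
  have finO: "finite (sch_O R K B 1 m p)" for p
    using finite_Xset[OF fin] by (simp add: sch_O_def)
  have "(\<Sum>a\<in>PiE {..<Suc K} (sch_O R K B 1 m). P y a) = 1" for y
    using sch_out_closed[OF x0 v0] finO unfolding P_def by (simp add: finite_PiE)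
  hence ns: "ns_scheme R K B 1 m P"
    unfolding ns_scheme_def ns_box_def using finO by (simp add: m_def P_def)
  have err: "sch_err R K B M 1 m P k = 0" if "k < K" for k
  proof -
    have "v k = w k" if "v \<in> Wset K m" "w \<in> Wset K m" for v w
      using WsetD[OF that(1) \<open>k < K\<close>] WsetD[OF that(2) \<open>k < K\<close>] by (simp add: m_def)
    hence "(if v k \<noteq> w k then P y a else 0) = 0" if "v \<in> Wset K m" "w \<in> Wset K m" for v w y a
      using that by simp
    thus ?thesis unfolding sch_err_def by simp
  qed
  show ?thesis
    unfolding rate_achievable_def
    by (rule exI[of _ "\<lambda>_. 1"], rule exI[of _ "\<lambda>_. m"], rule exI[of _ "\<lambda>_. P"])
      (use ns err in \<open>simp add: m_def Liminf_const\<close>)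
qed

end

section \<open>Passage to closures and to degrees of freedom\<close>

lemma closed_sum_le: fixes K :: nat shows "closed {r :: nat \<Rightarrow> real. (\<Sum>k<K. r k) \<le> c}"
  by (intro closed_Collect_le continuous_on_sum continuous_on_product_coordinates continuous_on_const)

text \<open>The half-space cut out by the bound is closed in the product topology, so it contains
  the closure along with \<open>A\<close>.\<close>

lemma Sup_sum_closure_le:
  fixes A :: "(nat \<Rightarrow> real) set" and K :: nat
  assumes "A \<noteq> {}" "\<And>r. r \<in> A \<Longrightarrow> (\<Sum>k<K. r k) \<le> (c::real)"
  shows "Sup ((\<lambda>r. \<Sum>k<K. r k) ` closure A) \<le> c"
proof (rule cSup_least)
  show "(\<lambda>r. \<Sum>k<K. r k) ` closure A \<noteq> {}" using assms(1) by simp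
  have "closure A \<subseteq> {r. (\<Sum>k<K. r k) \<le> c}"
    using assms(2) by (intro closure_minimal closed_sum_le) auto
  thus "y \<le> c" if "y \<in> (\<lambda>r. \<Sum>k<K. r k) ` closure A" for y using that by blast
qed

lemma C_NS_le:
  assumes q: "primepow q"
  shows "C_NS K B M q / log 2 (real q) \<le> real (minrk (fieldq q) K B M)"
proof -
  interpret F: field "fieldq q" by (rule fieldq_is_field[OF q])
  have fin: "finite (carrier (fieldq q))" and card: "card (carrier (fieldq q)) = q"
    using fieldq_is_field(2)[OF q] by auto
  have "0 < log 2 (real q)" using primepow_gt_Suc_0[OF q] by simp
  moreover have "C_NS K B M q \<le> real (minrk (fieldq q) K B M) * log 2 (real q)"
    unfolding C_NS_def sum_cap_def
    using F.zero_rate_achievable[OF fin] F.rate_achievable_sum_le[OF fin] card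
    by (intro Sup_sum_closure_le) auto
  ultimately show ?thesis by (simp add: divide_le_eq)
qed

lemma eventually_pp_filter_primepow: "\<forall>\<^sub>F q in pp_filter. primepow q"
  unfolding pp_filter_def eventually_inf_principal by simp

lemma dof_achievable_sum_le:
  assumes "dof_achievable K B M d"
  shows "ereal (\<Sum>k<K. d k) \<le> Liminf pp_filter (\<lambda>q. ereal (real (minrk (fieldq q) K B M)))"
  unfolding le_Liminf_iff
proof (intro allI impI)
  fix y assume y: "y < ereal (\<Sum>k<K. d k)"
  \<comment> \<open>The test value \<open>y\<close> is an extended real and may be minus infinity; a
    real number in between permits arithmetic.\<close>
  obtain z where z: "y < ereal z" "z < (\<Sum>k<K. d k)"
    using ereal_dense2[OF y] by auto
  \<comment> \<open>Losing \<open>\<epsilon>\<close> in each of the \<open>K\<close> components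
    leaves \<open>z + \<epsilon>\<close>, so the sum stays strictly above \<open>z\<close>.\<close>
  define \<epsilon> where "\<epsilon> = ((\<Sum>k<K. d k) - z) / (real K + 1)"
  have \<epsilon>: "0 < \<epsilon>" "real K * \<epsilon> + \<epsilon> = (\<Sum>k<K. d k) - z"
  proof -
    have K: "0 < real K + 1" by simp
    show "0 < \<epsilon>" using z(2) K unfolding \<epsilon>_def by simp
    have "real K * \<epsilon> + \<epsilon> = (real K + 1) * \<epsilon>" by (simp add: distrib_right)
    also have "\<dots> = (\<Sum>k<K. d k) - z" using K unfolding \<epsilon>_def by simp
    finally show "real K * \<epsilon> + \<epsilon> = (\<Sum>k<K. d k) - z" .
  qed
  obtain Rt where Rt: "\<And>q. primepow q \<Longrightarrow> rate_achievable (fieldq q) K B M (Rt q)"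
    and dof: "\<And>k. k < K \<Longrightarrow> ereal (d k) \<le> Liminf pp_filter (\<lambda>q. ereal (Rt q k / log 2 (real q)))"
    using assms unfolding dof_achievable_def by blast
  have "\<forall>\<^sub>F q in pp_filter. \<forall>k\<in>{..<K}. d k - \<epsilon> < Rt q k / log 2 (real q)"
  proof (rule eventually_ball_finite)
    show "\<forall>k\<in>{..<K}. \<forall>\<^sub>F q in pp_filter. d k - \<epsilon> < Rt q k / log 2 (real q)"
    proof
      fix k assume "k \<in> {..<K}"
      moreover have "ereal (d k - \<epsilon>) < ereal (d k)" using \<epsilon> by simp
      ultimately show "\<forall>\<^sub>F q in pp_filter. d k - \<epsilon> < Rt q k / log 2 (real q)"
        using dof[of k] unfolding le_Liminf_iff by fastforce
    qed
  qed simp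
  thus "\<forall>\<^sub>F q in pp_filter. y < ereal (real (minrk (fieldq q) K B M))"
    using eventually_pp_filter_primepow
  proof eventually_elim
    case (elim q)
    interpret F: field "fieldq q" by (rule fieldq_is_field[OF elim(2)])
    have fin: "finite (carrier (fieldq q))" and card: "card (carrier (fieldq q)) = q"
      using fieldq_is_field(2)[OF elim(2)] by auto
    have lq: "0 < log 2 (real q)" using primepow_gt_Suc_0[OF elim(2)] by simp
    have "z < (\<Sum>k<K. d k - \<epsilon>)" using \<epsilon> by (simp add: sum_subtractf)
    also have "\<dots> \<le> (\<Sum>k<K. Rt q k / log 2 (real q))"
      using elim(1) by (intro sum_mono less_imp_le) auto
    also have "\<dots> \<le> real (minrk (fieldq q) K B M)"
      using F.rate_achievable_sum_le[OF fin Rt[OF elim(2)]] card lq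
      by (simp add: sum_divide_distrib[symmetric] divide_le_eq)
    finally show ?case using z(1) by (metis ereal_less_eq(3) less_imp_le less_le_trans)
  qed
qed

lemma dof_sum_le:
  "ereal (dof_sum K B M) \<le> Liminf pp_filter (\<lambda>q. ereal (real (minrk (fieldq q) K B M)))"
    (is "_ \<le> ?L")
proof -
  have "dof_achievable K B M (\<lambda>_. 0)"
    unfolding dof_achievable_def
  proof (intro exI[of _ "\<lambda>_ _. 0"] conjI allI impI)
    fix q :: nat assume q: "primepow q"
    interpret F: field "fieldq q" by (rule fieldq_is_field[OF q])
    show "rate_achievable (fieldq q) K B M (\<lambda>_. 0)"
      by (rule F.zero_rate_achievable) (simp add: fieldq_is_field(2)[OF q])
  qed (auto intro!: Liminf_bounded)
  hence ne: "{d. dof_achievable K B M d} \<noteq> {}" by blast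
  \<comment> \<open>The supremum bound needs a real number, while the limit inferior is an extended
    real; this excludes minus infinity.\<close>
  have "0 \<le> ?L" by (rule Liminf_bounded) simp
  show ?thesis
  proof (cases ?L)
    case (real l)
    have "dof_sum K B M \<le> l"
      unfolding dof_sum_def
      using dof_achievable_sum_le[of K B M] real by (intro Sup_sum_closure_le[OF ne]) auto
    thus ?thesis using real by simp
  next
    case PInf
    thus ?thesis by simp
  next
    case MInf
    thus ?thesis using \<open>0 \<le> ?L\<close> by simp
  qed
qed

theorem theorem8:
  fixes K B :: nat and M :: "nat \<Rightarrow> nat \<Rightarrow> bool"
  shows "(\<forall>q::nat. primepow q \<longrightarrow>
            C_NS K B M q / log 2 (real q) \<le> real (minrk (fieldq q) K B M)) \<and>
         ereal (dof_sum K B M) \<le> Liminf pp_filter (\<lambda>q. ereal (real (minrk (fieldq q) K B M)))"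
  using C_NS_le dof_sum_le by blast

end
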